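(* The following statements are equivalent (in ZFC): (1) There is a ccc Corson compactum without a dense metrizable subspace. (2) There is a compact ccc space which can be covered by $\omega_1$ nowhere dense subsets. (3) $MA_{\omega_1}$ fails.
   Context: A compact Hausdorff space $X$ is a Corson compactum if for some cardinal $\kappa$ it is homeomorphic to a subspace of $\Sigma(\mathbb{R}^\kappa)=\{x \in \mathbb{R}^\kappa : |\{\alpha<\kappa: x(\alpha)\neq 0\}| \leq \aleph_0\}$. A space is ccc if every family of pairwise disjoint non-empty open sets is countable. $MA_{\omega_1}$ is the statement: for every ccc poset $\mathbb{P}$ and every family of $\aleph_1$ dense subsets of $\mathbb{P}$ there is a filter on $\mathbb{P}$ meeting all of them.
   Formalization: In (2), "compact ccc space" is taken to mean a non-empty compact Hausdorff ccc space; without this, ω1 with the cofinite topology (covered by its singletons) or the empty space would satisfy (2) in ZFC, and the equivalence with (3) would fail under MA. *)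

theory Defs
  imports "HOL-Analysis.Analysis"
begin

definition at_most_aleph1 :: "'a set \<Rightarrow> bool" where
  "at_most_aleph1 A \<longleftrightarrow> ordLeq2 (card_of A) (cardSuc natLeq)"

definition ccc_space :: "'a topology \<Rightarrow> bool" where
  "ccc_space X \<longleftrightarrow>
     (\<forall>\<U>. (\<forall>U\<in>\<U>. openin X U \<and> U \<noteq> {}) \<and> pairwise disjnt \<U> \<longrightarrow> countable \<U>)"

definition nowhere_dense_in :: "'a topology \<Rightarrow> 'a set \<Rightarrow> bool" where
  "nowhere_dense_in X S \<longleftrightarrow> S \<subseteq> topspace X \<and> X interior_of (X closure_of S) = {}"

definition has_dense_metrizable_subspace :: "'a topology \<Rightarrow> bool" where
  "has_dense_metrizable_subspace X \<longleftrightarrow>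
     (\<exists>D. D \<subseteq> topspace X \<and> X closure_of D = topspace X \<and> metrizable_space (subtopology X D))"

definition Sigma_product :: "('k \<Rightarrow> real) set" where
  "Sigma_product = {x. countable {\<alpha>. x \<alpha> \<noteq> 0}}"

definition corson_compactum :: "'k itself \<Rightarrow> 'a topology \<Rightarrow> bool" where
  "corson_compactum _ X \<longleftrightarrow> compact_space X \<and> Hausdorff_space X \<and>
     (\<exists>f::'a \<Rightarrow> ('k \<Rightarrow> real).
        embedding_map X (subtopology (powertop_real (UNIV::'k set)) Sigma_product) f)"

definition statement1 :: "'a itself \<Rightarrow> 'k itself \<Rightarrow> bool" where
  "statement1 _ _ \<longleftrightarrow> (\<exists>X::'a topology.
      corson_compactum TYPE('k) X \<and> ccc_space X \<and> \<not> has_dense_metrizable_subspace X)"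

definition statement2 :: "'a itself \<Rightarrow> bool" where
  "statement2 _ \<longleftrightarrow> (\<exists>X::'a topology.
      compact_space X \<and> Hausdorff_space X \<and> ccc_space X \<and> topspace X \<noteq> {} \<and>
      (\<exists>\<N>. at_most_aleph1 \<N> \<and> (\<forall>N\<in>\<N>. nowhere_dense_in X N) \<and> \<Union>\<N> = topspace X))"

(* le q p means q extends (is stronger than) p *)

definition poset_on :: "'p set \<Rightarrow> ('p \<Rightarrow> 'p \<Rightarrow> bool) \<Rightarrow> bool" where
  "poset_on P le \<longleftrightarrow> (\<forall>p\<in>P. le p p) \<and>
     (\<forall>p\<in>P. \<forall>q\<in>P. le p q \<and> le q p \<longrightarrow> p = q) \<and>
     (\<forall>p\<in>P. \<forall>q\<in>P. \<forall>r\<in>P. le p q \<and> le q r \<longrightarrow> le p r)"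

definition compatible :: "'p set \<Rightarrow> ('p \<Rightarrow> 'p \<Rightarrow> bool) \<Rightarrow> 'p \<Rightarrow> 'p \<Rightarrow> bool" where
  "compatible P le p q \<longleftrightarrow> (\<exists>r\<in>P. le r p \<and> le r q)"

definition ccc_poset :: "'p set \<Rightarrow> ('p \<Rightarrow> 'p \<Rightarrow> bool) \<Rightarrow> bool" where
  "ccc_poset P le \<longleftrightarrow> (\<forall>A. A \<subseteq> P \<and>
     (\<forall>p\<in>A. \<forall>q\<in>A. p \<noteq> q \<longrightarrow> \<not> compatible P le p q) \<longrightarrow> countable A)"

definition dense_in_poset :: "'p set \<Rightarrow> ('p \<Rightarrow> 'p \<Rightarrow> bool) \<Rightarrow> 'p set \<Rightarrow> bool" where
  "dense_in_poset P le D \<longleftrightarrow> D \<subseteq> P \<and> (\<forall>p\<in>P. \<exists>d\<in>D. le d p)"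

definition filter_on :: "'p set \<Rightarrow> ('p \<Rightarrow> 'p \<Rightarrow> bool) \<Rightarrow> 'p set \<Rightarrow> bool" where
  "filter_on P le G \<longleftrightarrow> G \<subseteq> P \<and> G \<noteq> {} \<and>
     (\<forall>p\<in>G. \<forall>q\<in>P. le p q \<longrightarrow> q \<in> G) \<and>
     (\<forall>p\<in>G. \<forall>q\<in>G. \<exists>r\<in>G. le r p \<and> le r q)"

definition MA_omega1 :: "'p itself \<Rightarrow> bool" where
  "MA_omega1 _ \<longleftrightarrow> (\<forall>(P::'p set) le \<D>. poset_on P le \<and> P \<noteq> {} \<and> ccc_poset P le \<and>
      at_most_aleph1 \<D> \<and> (\<forall>D\<in>\<D>. dense_in_poset P le D) \<longrightarrow>
      (\<exists>G. filter_on P le G \<and> (\<forall>D\<in>\<D>. G \<inter> D \<noteq> {})))"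

end

(*
  If MA fails, this is witnessed by a ccc poset P of size aleph_1 (Loewenheim-Skolem), so among the
  dense sets one may include those deciding, for all p and q, whether r is below both or incompatible
  with one of them; then no centred subset of P meets all the dense sets D_xi. Fix countable predense
  sets {d xi n : n} in D_xi. The elements of omega_1 are taken to be subsets of omega, hence distinct
  reals. A condition (p, t, F) consists of p in P, a finite sequence t of numbers and a finite F in
  omega_1 such that for i < |t| at most i + 1 restrictions to t_i of members of F occur, and such
  that for alpha in F the i-th predecessor xi of alpha satisfies p <= d xi n for some n <= t_i. Long
  sequences t leave room for two sets F of the same type, which gives the ccc. In an uncountable
  centred set of conditions, the distinctness of the reals bounds every t_i, and a compactness
  argument yields a centred set {d xi (m xi) : xi}, a contradiction. (This is the theorem of
  Todorcevic and Velickovic that precaliber aleph_1 for all ccc posets implies MA.) The sets all of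
  whose finite subsets are bounded in the new poset then form a Corson compactum, which is ccc,
  nonseparable, and the union of the nowhere dense sets of points supported on initial segments.
  Conversely, under MA a ccc compactum has caliber omega_1, which leaves a ccc Corson compactum only
  countably many nontrivial coordinates.
*)

theory Submission
  imports Defs "HOL-Library.Countable_Set_Type"
begin

unbundle cardinal_syntax

section \<open>The first uncountable cardinal and sets of size at most aleph_1\<close>

definition omega1 :: "nat set set" where
  "omega1 = Field (cardSuc natLeq)"

definition preds :: "nat set \<Rightarrow> nat set set" where
  "preds \<alpha> = underS (cardSuc natLeq) \<alpha>"

lemma Card_order_omega1: "Card_order (cardSuc natLeq)"
  by (simp add: cardSuc_Card_order natLeq_Card_order)

lemma Well_order_omega1: "Well_order (cardSuc natLeq)"
  using Card_order_omega1 card_order_on_well_order_on by blast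

lemma infinite_omega1: "\<not> finite (Field (cardSuc natLeq))"
  using cardSuc_finite[OF natLeq_Card_order] by (simp add: Field_natLeq)

lemma countable_iff_ordLess_omega1: "countable A \<longleftrightarrow> |A| <o cardSuc natLeq"
  by (simp add: countable_card_le_natLeq cardSuc_ordLeq_ordLess natLeq_Card_order card_of_Card_order)

lemma uncountable_iff_omega1_ordLeq: "uncountable A \<longleftrightarrow> cardSuc natLeq \<le>o |A|"
  unfolding countable_iff_ordLess_omega1
  using not_ordLess_iff_ordLeq[OF Well_order_omega1 card_of_Well_order[of A]] .

lemma card_of_omega1: "|omega1| =o cardSuc natLeq"
  unfolding omega1_def by (rule card_of_Field_ordIso[OF Card_order_omega1])

lemma uncountable_omega1: "uncountable omega1"
  unfolding uncountable_iff_omega1_ordLeq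
  by (rule ordIso_imp_ordLeq[OF ordIso_symmetric[OF card_of_omega1]])

lemma countable_preds: "\<alpha> \<in> omega1 \<Longrightarrow> countable (preds \<alpha>)"
  unfolding omega1_def preds_def countable_iff_ordLess_omega1
  by (rule card_of_underS[OF Card_order_omega1])

text \<open>The order is total, so whatever is not strictly above \<open>\<xi>\<close> is
  \<open>\<xi>\<close> itself or one of its countably many predecessors. Hence every uncountable
  subset of \<open>omega1\<close> is cofinal.\<close>

lemma countable_nonsuccessors:
  assumes "\<xi> \<in> omega1" shows "countable {\<alpha>\<in>omega1. \<xi> \<notin> preds \<alpha>}"
proof -
  have "{\<alpha>\<in>omega1. \<xi> \<notin> preds \<alpha>} \<subseteq> insert \<xi> (preds \<xi>)"
  proof
    fix \<alpha> assume a: "\<alpha> \<in> {\<alpha>\<in>omega1. \<xi> \<notin> preds \<alpha>}"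
    have "total_on omega1 (cardSuc natLeq)"
      using Well_order_omega1 unfolding omega1_def well_order_on_def linear_order_on_def by blast
    then show "\<alpha> \<in> insert \<xi> (preds \<xi>)"
      using a assms unfolding total_on_def preds_def underS_def by blast
  qed
  then show ?thesis
    by (rule countable_subset) (simp add: countable_preds assms)
qed

text \<open>Asking only for an inclusion in an image of \<open>omega1\<close> covers the empty set
  as well and allows repetitions.\<close>

lemma at_most_aleph1_iff: "at_most_aleph1 A \<longleftrightarrow> (\<exists>f. A \<subseteq> f ` omega1)"
proof -
  have "at_most_aleph1 A \<longleftrightarrow> |A| \<le>o |omega1|"
    unfolding at_most_aleph1_def
    using ordLeq_ordIso_trans[OF _ card_of_omega1] ordLeq_ordIso_trans[OF _ ordIso_symmetric[OF card_of_omega1]]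
    by (rule iffI[rotated])
  also have "\<dots> \<longleftrightarrow> (\<exists>f. A \<subseteq> f ` omega1)"
  proof
    assume "|A| \<le>o |omega1|"
    then show "\<exists>f. A \<subseteq> f ` omega1" using card_of_ordLeq2[of A omega1] by (cases "A = {}") auto
  next
    assume "\<exists>f. A \<subseteq> f ` omega1"
    then obtain f where "A \<subseteq> f ` omega1" ..
    then show "|A| \<le>o |omega1|" by (rule ordLeq_transitive[OF card_of_mono1 card_of_image])
  qed
  finally show ?thesis .
qed

lemma omega1_inj_into_uncountable:
  assumes "uncountable B" obtains f where "inj_on f omega1" "f ` omega1 \<subseteq> B"
proof -
  have "|omega1| \<le>o |B|"
    using ordIso_ordLeq_trans[OF card_of_omega1] assms unfolding uncountable_iff_omega1_ordLeq by this
  then show ?thesis using that by (auto simp: card_of_ordLeq[symmetric])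
qed

lemma omega1_bounds_countable:
  assumes "countable C" "C \<subseteq> omega1" obtains \<alpha> where "\<alpha> \<in> omega1" "C \<subseteq> preds \<alpha>"
proof -
  have "countable (\<Union>\<xi>\<in>C. {\<alpha>\<in>omega1. \<xi> \<notin> preds \<alpha>})"
    using assms countable_nonsuccessors by blast
  then have "\<not> omega1 \<subseteq> (\<Union>\<xi>\<in>C. {\<alpha>\<in>omega1. \<xi> \<notin> preds \<alpha>})"
    using uncountable_omega1 countable_subset by blast
  then show ?thesis using that by blast
qed

lemma at_most_aleph1_image: "at_most_aleph1 A \<Longrightarrow> at_most_aleph1 (f ` A)"
  unfolding at_most_aleph1_def by (rule ordLeq_transitive[OF card_of_image])

lemma countable_imp_at_most_aleph1: "countable A \<Longrightarrow> at_most_aleph1 A"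
  unfolding at_most_aleph1_def countable_iff_ordLess_omega1 by (rule ordLess_imp_ordLeq)

lemma at_most_aleph1_Times: "at_most_aleph1 A \<Longrightarrow> at_most_aleph1 B \<Longrightarrow> at_most_aleph1 (A \<times> B)"
  unfolding at_most_aleph1_def
  by (rule card_of_Times_ordLeq_infinite_Field[OF infinite_omega1 _ _ Card_order_omega1])

lemma at_most_aleph1_UN:
  "at_most_aleph1 I \<Longrightarrow> (\<And>i. i \<in> I \<Longrightarrow> at_most_aleph1 (A i)) \<Longrightarrow> at_most_aleph1 (\<Union>i\<in>I. A i)"
  unfolding at_most_aleph1_def
  by (rule card_of_UNION_ordLeq_infinite_Field[OF infinite_omega1 Card_order_omega1]) auto

lemma at_most_aleph1_Un: "at_most_aleph1 A \<Longrightarrow> at_most_aleph1 B \<Longrightarrow> at_most_aleph1 (A \<union> B)"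
  unfolding at_most_aleph1_def
  by (rule card_of_Un_ordLeq_infinite_Field[OF infinite_omega1 _ _ Card_order_omega1])

text \<open>The reals are uncountable, so aleph_1 is at most their cardinality. This lets any
  structure of size aleph_1 be copied to the type \<open>real\<close>.\<close>

lemma at_most_aleph1_inj_real:
  assumes "at_most_aleph1 A" obtains f :: "'a \<Rightarrow> real" where "inj_on f A"
proof -
  have "|A| \<le>o |UNIV :: real set|"
    using assms uncountable_UNIV_real unfolding at_most_aleph1_def uncountable_iff_omega1_ordLeq
    by (rule ordLeq_transitive)
  then show ?thesis using that by (auto simp: card_of_ordLeq[symmetric])
qed

section \<open>Antichains, small subposets and filters\<close>

lemma maximal_pairwise:
  obtains M where "M \<subseteq> S" "pairwise R M" "\<And>x. x \<in> S - M \<Longrightarrow> \<exists>m\<in>M. \<not> (R x m \<and> R m x)"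
proof -
  let ?F = "{M. M \<subseteq> S \<and> pairwise R M}"
  have "\<exists>M\<in>?F. \<forall>X\<in>?F. M \<subseteq> X \<longrightarrow> X = M"
  proof (rule subset_Zorn')
    fix C assume C: "subset.chain ?F C"
    have "pairwise R (\<Union>C)"
    proof (rule pairwiseI)
      fix x y assume "x \<in> \<Union>C" "y \<in> \<Union>C" "x \<noteq> y"
      then obtain A where "A \<in> C" "x \<in> A" "y \<in> A"
        using C unfolding subset_chain_def by blast
      then show "R x y" using C \<open>x \<noteq> y\<close> unfolding subset_chain_def pairwise_def by blast
    qed
    then show "\<Union>C \<in> ?F" using C unfolding subset_chain_def by blast
  qed
  then obtain M where M: "M \<subseteq> S" "pairwise R M" "\<And>X. X \<subseteq> S \<Longrightarrow> pairwise R X \<Longrightarrow> M \<subseteq> X \<Longrightarrow> X = M"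
    by auto
  show ?thesis
  proof (rule that[OF M(1,2)])
    fix x assume x: "x \<in> S - M"
    then have "\<not> pairwise R (insert x M)" using M(3)[of "insert x M"] M(1) by auto
    then show "\<exists>m\<in>M. \<not> (R x m \<and> R m x)" using M(2) by (auto simp: pairwise_insert)
  qed
qed

definition quasiorder_on :: "'p set \<Rightarrow> ('p \<Rightarrow> 'p \<Rightarrow> bool) \<Rightarrow> bool" where
  "quasiorder_on P le \<longleftrightarrow> (\<forall>p\<in>P. le p p) \<and>
     (\<forall>p\<in>P. \<forall>q\<in>P. \<forall>r\<in>P. le p q \<and> le q r \<longrightarrow> le p r)"

lemma poset_on_imp_quasiorder_on: "poset_on P le \<Longrightarrow> quasiorder_on P le"
  unfolding poset_on_def quasiorder_on_def by blast

lemma quasiorder_onD: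
  assumes "quasiorder_on P le"
  shows quasiorder_on_refl: "p \<in> P \<Longrightarrow> le p p"
    and quasiorder_on_trans: "le p q \<Longrightarrow> le q r \<Longrightarrow> p \<in> P \<Longrightarrow> q \<in> P \<Longrightarrow> r \<in> P \<Longrightarrow> le p r"
  using assms unfolding quasiorder_on_def by blast+

lemma compatible_sym: "compatible P le p q \<longleftrightarrow> compatible P le q p"
  unfolding compatible_def by blast

lemma ccc_posetI:
  "(\<And>A. A \<subseteq> P \<Longrightarrow> (\<And>p q. p \<in> A \<Longrightarrow> q \<in> A \<Longrightarrow> p \<noteq> q \<Longrightarrow> \<not> compatible P le p q) \<Longrightarrow> countable A)
    \<Longrightarrow> ccc_poset P le"
  unfolding ccc_poset_def by simp

lemma ccc_posetD:
  "ccc_poset P le \<Longrightarrow> A \<subseteq> P \<Longrightarrow> (\<And>p q. p \<in> A \<Longrightarrow> q \<in> A \<Longrightarrow> p \<noteq> q \<Longrightarrow> \<not> compatible P le p q)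
    \<Longrightarrow> countable A"
  unfolding ccc_poset_def by simp

text \<open>An indexed form of ccc for families that may repeat values: equal values are compatible
  by reflexivity, and an injective family of pairwise incompatible values would be an uncountable
  antichain.\<close>

lemma ccc_poset_family:
  assumes pre: "quasiorder_on P le" and ccc: "ccc_poset P le"
    and S: "uncountable S" and f: "\<And>i. i \<in> S \<Longrightarrow> f i \<in> P"
  obtains i j where "i \<in> S" "j \<in> S" "i \<noteq> j" "compatible P le (f i) (f j)"
proof (rule ccontr)
  note witness = that
  assume no: "\<not> thesis"
  have inc: "\<not> compatible P le (f i) (f j)" if "i \<in> S" "j \<in> S" "i \<noteq> j" for i j
    using no that witness by blast
  have self: "compatible P le (f i) (f i)" if "i \<in> S" for i
    using f[OF that] quasiorder_on_refl[OF pre] unfolding compatible_def by blast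
  have "inj_on f S"
    using inc self by (metis inj_onI)
  moreover have "countable (f ` S)"
    by (rule ccc_posetD[OF ccc]) (use f inc in auto)
  ultimately show False using S countable_image_inj_eq by blast
qed

lemma ccc_poset_maximal_antichain:
  assumes pre: "quasiorder_on P le" and ccc: "ccc_poset P le" and S: "S \<subseteq> P"
  obtains A where "countable A" "A \<subseteq> S" "\<And>s. s \<in> S \<Longrightarrow> \<exists>a\<in>A. compatible P le s a"
proof -
  obtain M where M: "M \<subseteq> S" "pairwise (\<lambda>p q. \<not> compatible P le p q) M"
    and max: "\<And>x. x \<in> S - M \<Longrightarrow> \<exists>m\<in>M. \<not> (\<not> compatible P le x m \<and> \<not> compatible P le m x)"
    using maximal_pairwise[of S "\<lambda>p q. \<not> compatible P le p q"] by metis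
  have "countable M"
    by (rule ccc_posetD[OF ccc]) (use M S in \<open>auto simp: pairwise_def\<close>)
  moreover have "\<exists>a\<in>M. compatible P le s a" if "s \<in> S" for s
  proof (cases "s \<in> M")
    case True
    then show ?thesis
      using that S quasiorder_on_refl[OF pre] unfolding compatible_def by blast
  next
    case False
    then obtain m where "m \<in> M" "compatible P le s m \<or> compatible P le m s"
      using max[of s] \<open>s \<in> S\<close> by auto
    then show ?thesis using compatible_sym[of P le m s] by auto
  qed
  ultimately show ?thesis using that M(1) by blast
qed

text \<open>If this failed, the conditions compatible with only countably many
  \<open>q \<alpha>\<close> would be dense. A maximal antichain of such conditions is countable and
  every \<open>q \<alpha>\<close> is compatible with one of its members, so \<open>I\<close> would
  be a countable union of countable sets.\<close>

lemma ccc_poset_localize: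
  assumes pre: "quasiorder_on P le" and ccc: "ccc_poset P le"
    and q: "\<And>\<alpha>. \<alpha> \<in> I \<Longrightarrow> q \<alpha> \<in> P" and I: "uncountable I"
  obtains p0 where "p0 \<in> P"
    "\<And>p. p \<in> P \<Longrightarrow> le p p0 \<Longrightarrow> uncountable {\<alpha>\<in>I. compatible P le p (q \<alpha>)}"
proof (rule ccontr)
  note witness = that
  assume no: "\<not> thesis"
  define S where "S = {p\<in>P. countable {\<alpha>\<in>I. compatible P le p (q \<alpha>)}}"
  have dense: "\<exists>s\<in>S. le s p" if "p \<in> P" for p
    using no that witness
    unfolding S_def by blast
  obtain A where A: "countable A" "A \<subseteq> S" "\<And>s. s \<in> S \<Longrightarrow> \<exists>a\<in>A. compatible P le s a"
    using ccc_poset_maximal_antichain[OF pre ccc, of S] unfolding S_def by blast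
  have "I \<subseteq> (\<Union>a\<in>A. {\<alpha>\<in>I. compatible P le a (q \<alpha>)})"
  proof
    fix \<alpha> assume \<alpha>: "\<alpha> \<in> I"
    obtain s where s: "s \<in> S" "le s (q \<alpha>)" using dense[OF q[OF \<alpha>]] by blast
    obtain a where a: "a \<in> A" "compatible P le s a" using A(3)[OF s(1)] by blast
    obtain r where r: "r \<in> P" "le r s" "le r a" using a(2) unfolding compatible_def by blast
    have "le r (q \<alpha>)"
      using quasiorder_on_trans[OF pre r(2) s(2) r(1)] s(1) q[OF \<alpha>] unfolding S_def by blast
    then have "compatible P le a (q \<alpha>)" using r unfolding compatible_def by blast
    then show "\<alpha> \<in> (\<Union>a\<in>A. {\<alpha>\<in>I. compatible P le a (q \<alpha>)})" using a(1) \<alpha> by blast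
  qed
  moreover have "countable (\<Union>a\<in>A. {\<alpha>\<in>I. compatible P le a (q \<alpha>)})"
    using A(1,2) unfolding S_def by (intro countable_UN) auto
  ultimately show False using I countable_subset by blast
qed

text \<open>A Loewenheim-Skolem closure: starting from one point, close off under chosen common
  lower bounds and chosen extensions into each dense set. The former preserves compatibility, and
  thereby ccc; the latter preserves density.\<close>

lemma subposet_aleph1:
  assumes pre: "quasiorder_on P le" and P: "P \<noteq> {}"
    and \<D>: "at_most_aleph1 \<D>" "\<And>D. D \<in> \<D> \<Longrightarrow> dense_in_poset P le D"
  obtains P' where "P' \<subseteq> P" "P' \<noteq> {}" "at_most_aleph1 P'"
    "\<And>p q. p \<in> P' \<Longrightarrow> q \<in> P' \<Longrightarrow> compatible P le p q \<Longrightarrow> compatible P' le p q"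
    "\<And>D. D \<in> \<D> \<Longrightarrow> dense_in_poset P' le (D \<inter> P')"
proof -
  obtain p0 where p0: "p0 \<in> P" using P by blast
  \<comment> \<open>\<open>p0\<close> is the default for incompatible pairs, so that
    \<open>m\<close> never leaves \<open>P\<close>.\<close>
  define m where "m = (\<lambda>(p, q). if compatible P le p q then SOME r. r \<in> P \<and> le r p \<and> le r q else p0)"
  define e where "e = (\<lambda>(D, p). SOME d. d \<in> D \<and> le d p)"
  have m: "m (p, q) \<in> P" "compatible P le p q \<Longrightarrow> le (m (p, q)) p \<and> le (m (p, q)) q" for p q
  proof -
    have "m (p, q) \<in> P \<and> le (m (p, q)) p \<and> le (m (p, q)) q" if "compatible P le p q"
      using someI_ex[of "\<lambda>r. r \<in> P \<and> le r p \<and> le r q"] that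
      by (auto simp: m_def compatible_def)
    then show "m (p, q) \<in> P" "compatible P le p q \<Longrightarrow> le (m (p, q)) p \<and> le (m (p, q)) q"
      using p0 by (cases "compatible P le p q"; auto simp: m_def)+
  qed
  have e: "e (D, p) \<in> D \<and> le (e (D, p)) p \<and> e (D, p) \<in> P" if "D \<in> \<D>" "p \<in> P" for D p
    using someI_ex[of "\<lambda>d. d \<in> D \<and> le d p"] \<D>(2)[OF that(1)] that(2)
    by (auto simp: e_def dense_in_poset_def)
  define X where "X = rec_nat {p0} (\<lambda>_ Y. Y \<union> m ` (Y \<times> Y) \<union> e ` (\<D> \<times> Y))"
  have X0: "X 0 = {p0}" and XS: "X (Suc n) = X n \<union> m ` (X n \<times> X n) \<union> e ` (\<D> \<times> X n)" for n
    by (simp_all add: X_def)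
  have XP: "X n \<subseteq> P" for n
  proof (induction n)
    case (Suc n)
    then show ?case unfolding XS using m e by fast
  qed (use X0 p0 in simp)
  have Xa: "at_most_aleph1 (X n)" for n
  proof (induction n)
    case 0
    show ?case by (simp add: X0 countable_imp_at_most_aleph1)
  next
    case (Suc n)
    then show ?case unfolding XS
      by (intro at_most_aleph1_Un at_most_aleph1_image at_most_aleph1_Times \<D>(1))
  qed
  have X_mono: "mono X" by (rule mono_iff_le_Suc[THEN iffD2]) (auto simp: XS)
  show ?thesis
  proof (rule that[of "\<Union>n. X n"])
    show "(\<Union>n. X n) \<subseteq> P" using XP by blast
    show "(\<Union>n. X n) \<noteq> {}" using X0 by blast
    show "at_most_aleph1 (\<Union>n. X n)"
      by (rule at_most_aleph1_UN[OF countable_imp_at_most_aleph1 Xa]) auto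
    show "compatible (\<Union>n. X n) le p q"
      if pq: "p \<in> (\<Union>n. X n)" "q \<in> (\<Union>n. X n)" "compatible P le p q" for p q
    proof -
      obtain i j where "p \<in> X i" "q \<in> X j" using pq(1,2) by blast
      then have "p \<in> X (max i j)" "q \<in> X (max i j)"
        using monoD[OF X_mono, of i "max i j"] monoD[OF X_mono, of j "max i j"] by auto
      then have "m (p, q) \<in> X (Suc (max i j))" unfolding XS by blast
      then show ?thesis using m(2)[OF pq(3)] unfolding compatible_def by blast
    qed
    show "dense_in_poset (\<Union>n. X n) le (D \<inter> (\<Union>n. X n))" if "D \<in> \<D>" for D
      unfolding dense_in_poset_def
    proof (intro conjI ballI)
      fix p assume "p \<in> (\<Union>n. X n)"
      then obtain n where n: "p \<in> X n" by blast
      then have "e (D, p) \<in> X (Suc n)" unfolding XS using that by blast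
      then show "\<exists>d\<in>D \<inter> (\<Union>n. X n). le d p" using e[OF that, of p] XP n by blast
    qed auto
  qed
qed

lemma ccc_subposet:
  assumes ccc: "ccc_poset P le" and sub: "P' \<subseteq> P"
    and compat: "\<And>p q. p \<in> P' \<Longrightarrow> q \<in> P' \<Longrightarrow> compatible P le p q \<Longrightarrow> compatible P' le p q"
  shows "ccc_poset P' le"
proof (rule ccc_posetI)
  fix A
  assume A: "A \<subseteq> P'" "\<And>p q. p \<in> A \<Longrightarrow> q \<in> A \<Longrightarrow> p \<noteq> q \<Longrightarrow> \<not> compatible P' le p q"
  show "countable A"
    by (rule ccc_posetD[OF ccc]) (use A sub compat in \<open>meson subset_iff\<close>)+
qed

text \<open>This carries a directed set from a subposet back to a filter on the whole poset.\<close>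

lemma filter_on_upward_closure:
  assumes pre: "quasiorder_on P le" and sub: "P' \<subseteq> P"
    and G: "G \<subseteq> P'" "G \<noteq> {}" "\<And>p q. p \<in> G \<Longrightarrow> q \<in> G \<Longrightarrow> \<exists>r\<in>G. le r p \<and> le r q"
  shows "filter_on P le {p\<in>P. \<exists>g\<in>G. le g p}"
  unfolding filter_on_def
proof (intro conjI ballI impI)
  show "{p\<in>P. \<exists>g\<in>G. le g p} \<noteq> {}"
    using G(1,2) sub quasiorder_on_refl[OF pre] by blast
  fix p assume p: "p \<in> {p\<in>P. \<exists>g\<in>G. le g p}"
  then obtain g where g: "g \<in> G" "le g p" by blast
  show "q \<in> {p\<in>P. \<exists>g\<in>G. le g p}" if "q \<in> P" "le p q" for q
    using quasiorder_on_trans[OF pre g(2) that(2)] g(1) G(1) sub p that(1) by blast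
  fix q assume q: "q \<in> {p\<in>P. \<exists>g\<in>G. le g p}"
  then obtain h where h: "h \<in> G" "le h q" by blast
  obtain r where r: "r \<in> G" "le r g" "le r h" using G(3)[OF g(1) h(1)] by blast
  have "r \<in> P" "g \<in> P" "h \<in> P" using r(1) g(1) h(1) G(1) sub by blast+
  then have "le r p" "le r q" "le r r"
    using quasiorder_on_trans[OF pre r(2) g(2)] quasiorder_on_trans[OF pre r(3) h(2)]
      quasiorder_on_refl[OF pre] p q by blast+
  then show "\<exists>r\<in>{p\<in>P. \<exists>g\<in>G. le g p}. le r p \<and> le r q"
    using r(1) \<open>r \<in> P\<close> by blast
qed blast

lemma MA_omega1_filter:
  fixes P :: "'p set"
  assumes "MA_omega1 TYPE('p)" "poset_on P le" "P \<noteq> {}" "ccc_poset P le" "at_most_aleph1 I"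
    and D: "\<And>i. i \<in> I \<Longrightarrow> dense_in_poset P le (D i)"
  obtains G where "filter_on P le G" "\<And>i. i \<in> I \<Longrightarrow> G \<inter> D i \<noteq> {}"
proof -
  have "\<forall>E\<in>D ` I. dense_in_poset P le E" using D by auto
  then obtain G where "filter_on P le G" "\<forall>E\<in>D ` I. G \<inter> E \<noteq> {}"
    using assms(1)[unfolded MA_omega1_def, rule_format, of P le "D ` I"]
      assms(2-4) at_most_aleph1_image[OF assms(5), of D] by auto
  then show ?thesis using that by simp
qed

text \<open>Passing to a subposet of size at most aleph_1 preserves ccc and the given dense sets.
  The subposet injects into the reals, its order is transported there, and the filter obtained is
  pulled back and closed upwards in \<open>P\<close>.\<close>

lemma MA_omega1_real_imp_MA_omega1:
  assumes MA: "MA_omega1 TYPE(real)" shows "MA_omega1 TYPE('p)"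
  unfolding MA_omega1_def
proof (intro allI impI, elim conjE)
  fix P :: "'p set" and le and \<D>
  assume P: "poset_on P le" "P \<noteq> {}" "ccc_poset P le" and \<D>: "at_most_aleph1 \<D>" "\<forall>D\<in>\<D>. dense_in_poset P le D"
  note pre = poset_on_imp_quasiorder_on[OF P(1)]
  obtain P' where P': "P' \<subseteq> P" "P' \<noteq> {}" "at_most_aleph1 P'"
    and compat: "\<And>p q. p \<in> P' \<Longrightarrow> q \<in> P' \<Longrightarrow> compatible P le p q \<Longrightarrow> compatible P' le p q"
    and dense: "\<And>D. D \<in> \<D> \<Longrightarrow> dense_in_poset P' le (D \<inter> P')"
    using subposet_aleph1[OF pre P(2) \<D>(1)] \<D>(2) by blast
  obtain f :: "'p \<Rightarrow> real" where f: "inj_on f P'" using at_most_aleph1_inj_real[OF P'(3)] by blast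
  define g where "g = the_inv_into P' f"
  have gf: "g (f p) = p" if "p \<in> P'" for p
    unfolding g_def by (rule the_inv_into_f_f[OF f that])
  define le' where "le' x y = le (g x) (g y)" for x y
  have po: "poset_on (f ` P') le'"
    using P(1) P'(1) unfolding poset_on_def le'_def by (simp add: gf) blast
  have cc: "ccc_poset (f ` P') le'"
  proof (rule ccc_posetI)
    fix A assume A: "A \<subseteq> f ` P'"
      and inc: "\<And>p q. p \<in> A \<Longrightarrow> q \<in> A \<Longrightarrow> p \<noteq> q \<Longrightarrow> \<not> compatible (f ` P') le' p q"
    have fg: "f (g a) = a" "g a \<in> P'" if "a \<in> A" for a using A that gf by auto
    have "\<not> compatible P' le (g a) (g b)" if "a \<in> A" "b \<in> A" "a \<noteq> b" for a b
      using inc[OF that] unfolding compatible_def le'_def by (auto simp: gf)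
    then have "countable (g ` A)"
      by (intro ccc_posetD[OF ccc_subposet[OF P(3) P'(1) compat]]) (use fg(2) in auto)
    moreover have "inj_on g A" using fg(1) by (metis inj_onI)
    ultimately show "countable A" using countable_image_inj_on by blast
  qed
  have de: "dense_in_poset (f ` P') le' (f ` (D \<inter> P'))" if "D \<in> \<D>" for D
    using dense[OF that] unfolding dense_in_poset_def le'_def by (auto simp: gf)
  have ne: "f ` P' \<noteq> {}" using P'(2) by simp
  obtain G where G: "filter_on (f ` P') le' G"
    "\<And>D. D \<in> \<D> \<Longrightarrow> G \<inter> f ` (D \<inter> P') \<noteq> {}"
    using MA_omega1_filter[OF MA po ne cc \<D>(1), of "\<lambda>D. f ` (D \<inter> P')", OF de] by blast
  have gG: "g ` G \<subseteq> P'" using G(1) gf unfolding filter_on_def by fastforce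
  have "filter_on P le {p\<in>P. \<exists>h\<in>g ` G. le h p}"
  proof (rule filter_on_upward_closure[OF pre P'(1) gG])
    show "g ` G \<noteq> {}" using G(1) unfolding filter_on_def by blast
    show "\<exists>r\<in>g ` G. le r p \<and> le r q" if "p \<in> g ` G" "q \<in> g ` G" for p q
      using G(1) that unfolding filter_on_def le'_def by blast
  qed
  moreover have "{p\<in>P. \<exists>h\<in>g ` G. le h p} \<inter> D \<noteq> {}" if D: "D \<in> \<D>" for D
  proof -
    obtain d where "d \<in> D \<inter> P'" "f d \<in> G" using G(2) D by blast
    moreover from this have "d \<in> g ` G" using gf[of d] by (metis IntD2 image_eqI)
    ultimately show ?thesis using P'(1) quasiorder_on_refl[OF pre] by blast
  qed
  ultimately show "\<exists>G. filter_on P le G \<and> (\<forall>D\<in>\<D>. G \<inter> D \<noteq> {})" by blast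
qed

section \<open>Pigeonhole and compactness for finite choices\<close>

lemma uncountable_fiber:
  assumes "uncountable A" "countable C" "f ` A \<subseteq> C"
  obtains c where "c \<in> C" "uncountable {a\<in>A. f a = c}"
proof -
  have "A \<subseteq> (\<Union>c\<in>C. {a\<in>A. f a = c})" using assms(3) by blast
  then have "uncountable (\<Union>c\<in>C. {a\<in>A. f a = c})" using assms(1) countable_subset by blast
  then have "\<exists>c\<in>C. uncountable {a\<in>A. f a = c}"
    using countable_UN[OF assms(2), of "\<lambda>c. {a\<in>A. f a = c}"] by auto
  then show ?thesis using that by blast
qed

lemma open_finitely_determined:
  fixes U :: "('i \<Rightarrow> 'b::discrete_topology) set"
  assumes Z: "finite Z" and U: "\<And>f g. f \<in> U \<Longrightarrow> (\<And>z. z \<in> Z \<Longrightarrow> g z = f z) \<Longrightarrow> g \<in> U"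
  shows "open U"
proof (subst open_subopen, intro ballI)
  fix f assume f: "f \<in> U"
  have "open {g. \<forall>z\<in>Z. g (id z) \<in> {f z}}"
    by (rule product_topology_basis'[OF Z]) (simp add: open_discrete)
  moreover have "{g. \<forall>z\<in>Z. g (id z) \<in> {f z}} \<subseteq> U" using U[OF f] by auto
  ultimately show "\<exists>T. open T \<and> f \<in> T \<and> T \<subseteq> U"
    by (intro exI[of _ "{g. \<forall>z\<in>Z. g (id z) \<in> {f z}}"]) simp
qed

lemma compact_PiE_UNIV:
  fixes S :: "'i \<Rightarrow> 'b::topological_space set"
  assumes "\<And>i. compact (S i)" shows "compact (Pi\<^sub>E UNIV S)"
proof -
  have "compactin (product_topology (\<lambda>i::'i. euclidean :: 'b topology) UNIV) (Pi\<^sub>E UNIV S)"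
    using assms by (subst compactin_PiE) auto
  then show ?thesis by (simp add: euclidean_product_topology)
qed

text \<open>The box of functions bounded by \<open>H\<close> is compact. For finite
  \<open>Z\<close>, \<open>G Z\<close> depends on finitely many discrete coordinates and so defines
  a closed set; finitely many of these sets have a common point, obtained from \<open>ex\<close> for
  the union of their index sets together with \<open>anti\<close>.\<close>

lemma finite_choice_compactness:
  fixes G :: "'i set \<Rightarrow> ('i \<Rightarrow> nat) \<Rightarrow> bool"
  assumes ex: "\<And>Z. finite Z \<Longrightarrow> Z \<subseteq> I \<Longrightarrow> \<exists>m. (\<forall>z\<in>Z. m z \<le> H z) \<and> G Z m"
    and cong: "\<And>Z m m'. G Z m \<Longrightarrow> (\<And>z. z \<in> Z \<Longrightarrow> m' z = m z) \<Longrightarrow> G Z m'"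
    and anti: "\<And>Z Z' m. G Z m \<Longrightarrow> Z' \<subseteq> Z \<Longrightarrow> G Z' m"
  obtains m where "\<And>Z. finite Z \<Longrightarrow> Z \<subseteq> I \<Longrightarrow> G Z m"
proof -
  let ?F = "(\<lambda>Z. Collect (G Z)) ` {Z. finite Z \<and> Z \<subseteq> I}"
  have "Pi\<^sub>E UNIV (\<lambda>z. {..H z}) \<inter> \<Inter>?F \<noteq> {}"
  proof (rule compact_imp_fip)
    show "compact (Pi\<^sub>E UNIV (\<lambda>z. {..H z}))"
      by (rule compact_PiE_UNIV) (simp add: finite_imp_compact)
    show "closed T" if T: "T \<in> ?F" for T
    proof -
      obtain Z where Z: "finite Z" "T = Collect (G Z)" using T by blast
      have "open (- T)"
        by (rule open_finitely_determined[OF Z(1)]) (use Z(2) cong in auto)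
      then show ?thesis by (simp add: closed_def)
    qed
    show "Pi\<^sub>E UNIV (\<lambda>z. {..H z}) \<inter> \<Inter>F' \<noteq> {}" if F': "finite F'" "F' \<subseteq> ?F" for F'
    proof -
      obtain \<Z> where \<Z>: "finite \<Z>" "\<Z> \<subseteq> {Z. finite Z \<and> Z \<subseteq> I}" "F' = (\<lambda>Z. Collect (G Z)) ` \<Z>"
        using finite_subset_image[OF F'] by blast
      obtain m where m: "\<forall>z\<in>\<Union>\<Z>. m z \<le> H z" "G (\<Union>\<Z>) m"
        using ex[of "\<Union>\<Z>"] \<Z>(1,2) by blast
      \<comment> \<open>Nothing bounds \<open>m\<close> outside the finitely many relevant
        coordinates, so it is reset to 0 there to lie in the box.\<close>
      let ?m = "\<lambda>z. if z \<in> \<Union>\<Z> then m z else 0"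
      have "G (\<Union>\<Z>) ?m" using cong[OF m(2), of ?m] by simp
      then have "?m \<in> \<Inter>F'" using anti \<Z>(3) by blast
      moreover have "?m \<in> Pi\<^sub>E UNIV (\<lambda>z. {..H z})" using m(1) by auto
      ultimately show ?thesis by blast
    qed
  qed
  then show ?thesis using that by blast
qed

lemma finite_separating_level:
  fixes F :: "nat set set"
  assumes "finite F" obtains n where "inj_on (\<lambda>\<alpha>. \<alpha> \<inter> {..<n}) F"
proof -
  have "\<exists>k :: nat set \<Rightarrow> nat set \<Rightarrow> nat. \<forall>\<alpha> \<beta>. \<alpha> \<noteq> \<beta> \<longrightarrow> (k \<alpha> \<beta> \<in> \<alpha>) \<noteq> (k \<alpha> \<beta> \<in> \<beta>)"
    by (intro choice allI) (metis set_eqI)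
  then obtain k :: "nat set \<Rightarrow> nat set \<Rightarrow> nat"
    where k: "\<And>\<alpha> \<beta>. \<alpha> \<noteq> \<beta> \<Longrightarrow> (k \<alpha> \<beta> \<in> \<alpha>) \<noteq> (k \<alpha> \<beta> \<in> \<beta>)" by blast
  \<comment> \<open>The sum bounds every chosen point of difference
    \<open>k \<alpha> \<beta>\<close>; the successor makes the bound strict.\<close>
  define n where "n = Suc (\<Sum>x\<in>F \<times> F. k (fst x) (snd x))"
  have "inj_on (\<lambda>\<alpha>. \<alpha> \<inter> {..<n}) F"
  proof (rule inj_onI, rule ccontr)
    fix \<alpha> \<beta> assume ab: "\<alpha> \<in> F" "\<beta> \<in> F" "\<alpha> \<inter> {..<n} = \<beta> \<inter> {..<n}" "\<alpha> \<noteq> \<beta>"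
    have "k \<alpha> \<beta> \<le> (\<Sum>x\<in>F \<times> F. k (fst x) (snd x))"
      using member_le_sum[of "(\<alpha>, \<beta>)" "F \<times> F" "\<lambda>x. k (fst x) (snd x)"] ab(1,2) assms by simp
    then have "k \<alpha> \<beta> \<in> {..<n}" by (simp add: n_def)
    then show False using ab(3) k[OF ab(4)] by blast
  qed
  then show ?thesis using that by blast
qed

section \<open>The ccc poset of slalom conditions\<close>

lemma preds_subset: "preds \<alpha> \<subseteq> omega1"
  unfolding preds_def omega1_def underS_def Field_def by blast

locale predense_family =
  fixes P :: "'p set" and le :: "'p \<Rightarrow> 'p \<Rightarrow> bool" and d :: "nat set \<Rightarrow> nat \<Rightarrow> 'p"
  assumes pre: "quasiorder_on P le" and ccc: "ccc_poset P le" and P_ne: "P \<noteq> {}"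
    and d: "\<And>\<xi> n. \<xi> \<in> omega1 \<Longrightarrow> d \<xi> n \<in> P"
    and predense: "\<And>\<xi> p. \<xi> \<in> omega1 \<Longrightarrow> p \<in> P \<Longrightarrow> \<exists>n. compatible P le p (d \<xi> n)"
begin

text \<open>The conditions of \<open>Q\<close> below: \<open>t\<close> is a slalom-like sequence of numbers, and \<open>\<alpha> \<in> F\<close> promises that the
  \<open>i\<close>-th element \<open>\<xi>\<close> of \<open>preds \<alpha>\<close> is decided by one of \<open>d \<xi> 0, \<dots>, d \<xi> (t ! i)\<close>. The bound \<open>i + 1\<close> on the
  number of restrictions of members of \<open>F\<close> to \<open>t ! i\<close> is what keeps \<open>t\<close> from growing arbitrarily fast.\<close>

definition approx :: "'p \<Rightarrow> nat list \<Rightarrow> nat set set \<Rightarrow> bool" where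
  "approx p t F \<longleftrightarrow> p \<in> P \<and> finite F \<and> F \<subseteq> omega1 \<and>
     (\<forall>i<length t. card ((\<lambda>\<alpha>. \<alpha> \<inter> {..<t ! i}) ` F) \<le> Suc i) \<and>
     (\<forall>i<length t. \<forall>\<alpha>\<in>F. \<forall>\<xi>\<in>preds \<alpha>. to_nat_on (preds \<alpha>) \<xi> = i \<longrightarrow> (\<exists>n\<le>t ! i. le p (d \<xi> n)))"

text \<open>The bound on \<open>card F\<close> leaves room to lengthen \<open>t\<close>: at any
  index from \<open>length t\<close> on, \<open>F\<close> has few enough restrictions whatever the
  new entry is. Conversely, it forces \<open>t\<close> to be long when \<open>F\<close> is
  large.\<close>

definition Q :: "('p \<times> nat list \<times> nat set set) set" where
  "Q = {(p, t, F). approx p t F \<and> card F \<le> length t}"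

definition leQ :: "'p \<times> nat list \<times> nat set set \<Rightarrow> 'p \<times> nat list \<times> nat set set \<Rightarrow> bool" where
  "leQ = (\<lambda>(p', t', F') (p, t, F). le p' p \<and> take (length t) t' = t \<and> F \<subseteq> F')"

lemma quasiorder_on_Q: "quasiorder_on Q leQ"
proof -
  have tk: "take (length r) p = r"
    if "take (length q) p = q" "take (length r) q = r" for p q r :: "nat list"
    using that by (metis append_take_drop_id length_append take_append take_take
        le_add1 min.absorb1 length_take min.cobounded1 min.absorb2)
  show ?thesis
    unfolding quasiorder_on_def
  proof (intro conjI ballI impI)
    fix x assume "x \<in> Q"
    then show "leQ x x" using quasiorder_on_refl[OF pre] by (auto simp: Q_def leQ_def approx_def)
  next
    fix x y z assume "x \<in> Q" "y \<in> Q" "z \<in> Q" "leQ x y \<and> leQ y z"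
    moreover obtain p t F where x: "x = (p, t, F)" by (rule prod_cases3)
    moreover obtain p' t' F' where y: "y = (p', t', F')" by (rule prod_cases3)
    moreover obtain p'' t'' F'' where z: "z = (p'', t'', F'')" by (rule prod_cases3)
    ultimately have "p \<in> P" "p' \<in> P" "p'' \<in> P" "le p p'" "le p' p''"
      "take (length t') t = t'" "take (length t'') t' = t''" "F'' \<subseteq> F'" "F' \<subseteq> F"
      by (simp_all add: Q_def leQ_def approx_def)
    then have "le p p''" "take (length t'') t = t''" "F'' \<subseteq> F"
      using quasiorder_on_trans[OF pre, of p p' p''] tk[of t' t t''] by auto
    then show "leQ x z" by (simp add: leQ_def x z)
  qed
qed

lemma meet_finitely_many:
  assumes "finite X" "X \<subseteq> omega1" "p \<in> P"
  shows "\<exists>p'\<in>P. le p' p \<and> (\<forall>\<xi>\<in>X. \<exists>n. le p' (d \<xi> n))"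
  using assms
proof (induction X rule: finite_induct)
  case empty
  then show ?case using quasiorder_on_refl[OF pre] by blast
next
  case (insert \<xi> X)
  then obtain p' where p': "p' \<in> P" "le p' p" "\<forall>\<xi>\<in>X. \<exists>n. le p' (d \<xi> n)" by blast
  have \<xi>: "\<xi> \<in> omega1" using insert.prems by blast
  obtain n r where r: "r \<in> P" "le r p'" "le r (d \<xi> n)"
    using predense[OF \<xi> p'(1)] unfolding compatible_def by blast
  have "le r p" by (rule quasiorder_on_trans[OF pre r(2) p'(2) r(1) p'(1) insert.prems(2)])
  moreover have "\<exists>n. le r (d \<eta> n)" if \<eta>: "\<eta> \<in> X" for \<eta>
  proof -
    obtain k where "le p' (d \<eta> k)" using p'(3) \<eta> by blast
    then show ?thesis
      using quasiorder_on_trans[OF pre r(2) _ r(1) p'(1) d] insert.prems(1) \<eta> by blast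
  qed
  ultimately show ?case using r by blast
qed

text \<open>By the assumption on \<open>card F\<close> the slalom bound at the new index holds for
  every \<open>k\<close>, so \<open>k\<close> can be taken large enough for the finitely many
  decisions that this index demands.\<close>

lemma approx_extend:
  assumes a: "approx p t F" and c: "card F \<le> Suc (length t)"
  shows "\<exists>p' k. approx p' (t @ [k]) F \<and> le p' p"
proof -
  \<comment> \<open>The ordinals standing at place \<open>length t\<close> in the enumeration of
    some \<open>preds \<alpha>\<close>. Each \<open>\<alpha>\<close> contributes at most one, so
    there are finitely many.\<close>
  define X where "X = (\<Union>\<alpha>\<in>F. {\<xi>\<in>preds \<alpha>. to_nat_on (preds \<alpha>) \<xi> = length t})"
  have F: "finite F" "F \<subseteq> omega1" and p: "p \<in> P" using a unfolding approx_def by blast+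
  have "finite {\<xi>\<in>preds \<alpha>. to_nat_on (preds \<alpha>) \<xi> = length t}" if \<alpha>: "\<alpha> \<in> F" for \<alpha>
  proof -
    have "inj_on (to_nat_on (preds \<alpha>)) (preds \<alpha>)"
      using countable_preds \<alpha> F(2) by (intro inj_on_to_nat_on) blast
    then have "finite (to_nat_on (preds \<alpha>) -` {length t} \<inter> preds \<alpha>)"
      by (intro finite_vimage_IntI) auto
    then show ?thesis by (rule rev_finite_subset) auto
  qed
  then have X: "finite X" unfolding X_def using F(1) by blast
  have "X \<subseteq> omega1" unfolding X_def using preds_subset by blast
  then obtain p' where p': "p' \<in> P" "le p' p" "\<forall>\<xi>\<in>X. \<exists>n. le p' (d \<xi> n)"
    using meet_finitely_many[OF X _ p] by blast
  then obtain n where n: "\<forall>\<xi>\<in>X. le p' (d \<xi> (n \<xi>))" by metis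
  define k where "k = sum n X"
  have nk: "n \<xi> \<le> k" if "\<xi> \<in> X" for \<xi>
    unfolding k_def using member_le_sum[of \<xi> X n] that X by simp
  have old: "\<exists>m\<le>t ! i. le p' (d \<xi> m)"
    if h: "i < length t" "\<alpha> \<in> F" "\<xi> \<in> preds \<alpha>" "to_nat_on (preds \<alpha>) \<xi> = i" for i \<alpha> \<xi>
  proof -
    obtain m where "m \<le> t ! i" "le p (d \<xi> m)" using a h unfolding approx_def by blast
    then show ?thesis
      using quasiorder_on_trans[OF pre p'(2) _ p'(1) p d] preds_subset h(3) by blast
  qed
  have new: "\<exists>m\<le>k. le p' (d \<xi> m)"
    if "\<alpha> \<in> F" "\<xi> \<in> preds \<alpha>" "to_nat_on (preds \<alpha>) \<xi> = length t" for \<alpha> \<xi>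
    using that n nk unfolding X_def by blast
  have "card ((\<lambda>\<alpha>. \<alpha> \<inter> {..<k}) ` F) \<le> Suc (length t)"
    using card_image_le[OF F(1)] c le_trans by blast
  then have "approx p' (t @ [k]) F"
    using a p'(1) old new unfolding approx_def by (auto simp: nth_append less_Suc_eq)
  then show ?thesis using p'(2) by blast
qed

lemma approx_extend_by:
  assumes a: "approx p t F" and c: "card F \<le> length t"
  shows "\<exists>p' t'. approx p' t' F \<and> le p' p \<and> take (length t) t' = t \<and> length t' = length t + k"
proof (induction k)
  case 0
  have "le p p" using a quasiorder_on_refl[OF pre] unfolding approx_def by blast
  then show ?case using a by (intro exI[of _ p] exI[of _ t]) simp
next
  case (Suc k)
  then obtain p' t' where 1: "approx p' t' F" "le p' p" "take (length t) t' = t" "length t' = length t + k"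
    by blast
  obtain p'' m where 2: "approx p'' (t' @ [m]) F" "le p'' p'"
    using approx_extend[OF 1(1)] c 1(4) by auto
  have "le p'' p"
    using quasiorder_on_trans[OF pre 2(2) 1(2)] 1(1) 2(1) a unfolding approx_def by blast
  then show ?case using 1 2 by (intro exI[of _ p''] exI[of _ "t' @ [m]"]) auto
qed

text \<open>Lengthen every condition until \<open>t\<close> has at least twice as many entries as
  \<open>F\<close> has elements. Uncountably many conditions then agree on \<open>t\<close> and on
  the traces of \<open>F\<close> below a bound for all entries of \<open>t\<close>, and two of these
  have compatible first components. Uniting their sets \<open>F\<close> creates no new
  restrictions.\<close>

lemma ccc_poset_Q: "ccc_poset Q leQ"
proof (rule ccc_posetI, rule ccontr)
  fix A
  assume A: "A \<subseteq> Q" and inc: "\<And>x y. x \<in> A \<Longrightarrow> y \<in> A \<Longrightarrow> x \<noteq> y \<Longrightarrow> \<not> compatible Q leQ x y"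
    and unc: "uncountable A"
  have "\<forall>x\<in>A. \<exists>p' t'. approx p' t' (snd (snd x)) \<and> le p' (fst x) \<and>
          take (length (fst (snd x))) t' = fst (snd x) \<and> 2 * card (snd (snd x)) \<le> length t'"
  proof
    fix x assume x: "x \<in> A"
    obtain p t F where x_eq: "x = (p, t, F)" by (metis prod.exhaust)
    then have a: "approx p t F" and c: "card F \<le> length t" using x A by (auto simp: Q_def)
    obtain p' t' where "approx p' t' F" "le p' p" "take (length t) t' = t" "length t' = length t + length t"
      using approx_extend_by[OF a c] by blast
    then show "\<exists>p' t'. approx p' t' (snd (snd x)) \<and> le p' (fst x) \<and>
          take (length (fst (snd x))) t' = fst (snd x) \<and> 2 * card (snd (snd x)) \<le> length t'"
      using c by (intro exI[of _ p'] exI[of _ t']) (simp add: x_eq)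
  qed
  then obtain p t where pt: "\<And>x. x \<in> A \<Longrightarrow> approx (p x) (t x) (snd (snd x))"
      "\<And>x. x \<in> A \<Longrightarrow> le (p x) (fst x)"
      "\<And>x. x \<in> A \<Longrightarrow> take (length (fst (snd x))) (t x) = fst (snd x)"
      "\<And>x. x \<in> A \<Longrightarrow> 2 * card (snd (snd x)) \<le> length (t x)"
    by metis
  \<comment> \<open>\<open>sum_list (t x)\<close> bounds every entry of \<open>t x\<close>, so the
    second component determines the restrictions at all levels \<open>t x ! i\<close>. It is a
    finite set of finite sets, so only countably many values occur.\<close>
  define \<tau> where "\<tau> x = (t x, (\<lambda>\<alpha>. \<alpha> \<inter> {..<sum_list (t x)}) ` snd (snd x))" for x
  have "countable ((UNIV :: nat list set) \<times> {S :: nat set set. finite S \<and> S \<subseteq> Collect finite})"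
    by (intro countable_SIGMA countable_Collect_finite_subset countable_Collect_finite) auto
  moreover have "\<tau> ` A \<subseteq> UNIV \<times> {S. finite S \<and> S \<subseteq> Collect finite}"
    using pt(1) by (auto simp: \<tau>_def approx_def)
  ultimately obtain c where c: "uncountable {x\<in>A. \<tau> x = c}"
    by (rule uncountable_fiber[OF unc])
  have "p x \<in> P" if "x \<in> {x\<in>A. \<tau> x = c}" for x using pt(1) that unfolding approx_def by blast
  then obtain x y where xy: "x \<in> A" "y \<in> A" "\<tau> x = \<tau> y" "x \<noteq> y" "compatible P le (p x) (p y)"
    using ccc_poset_family[OF pre ccc c, of p] by (metis (mono_tags, lifting) mem_Collect_eq)
  obtain r where r: "r \<in> P" "le r (p x)" "le r (p y)" using xy(5) unfolding compatible_def by blast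
  let ?F = "snd (snd x)" and ?G = "snd (snd y)"
  have \<tau>_eq: "t x = t y" "(\<lambda>\<alpha>. \<alpha> \<inter> {..<sum_list (t x)}) ` ?F = (\<lambda>\<alpha>. \<alpha> \<inter> {..<sum_list (t y)}) ` ?G"
    using xy(3) unfolding \<tau>_def prod.inject by blast+
  have t_eq: "t y = t x" and lv: "(\<lambda>\<alpha>. \<alpha> \<inter> {..<sum_list (t x)}) ` ?G = (\<lambda>\<alpha>. \<alpha> \<inter> {..<sum_list (t x)}) ` ?F"
    using \<tau>_eq by simp_all
  note ax = pt(1)[OF xy(1)] and ay = pt(1)[OF xy(2), unfolded t_eq]
  have lv_i: "(\<lambda>\<alpha>. \<alpha> \<inter> {..<t x ! i}) ` (?F \<union> ?G) = (\<lambda>\<alpha>. \<alpha> \<inter> {..<t x ! i}) ` ?F" if i: "i < length (t x)" for i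
  proof -
    have le: "t x ! i \<le> sum_list (t x)" using elem_le_sum_list[OF i] .
    have coarse: "(\<lambda>\<alpha>. \<alpha> \<inter> {..<t x ! i}) ` H = (\<lambda>\<beta>. \<beta> \<inter> {..<t x ! i}) ` (\<lambda>\<alpha>. \<alpha> \<inter> {..<sum_list (t x)}) ` H" for H
      unfolding image_image using le by (intro image_cong refl) auto
    have "(\<lambda>\<alpha>. \<alpha> \<inter> {..<t x ! i}) ` ?G = (\<lambda>\<alpha>. \<alpha> \<inter> {..<t x ! i}) ` ?F"
      unfolding coarse[of ?G] coarse[of ?F] lv ..
    then show ?thesis unfolding image_Un by simp
  qed
  have mono: "\<exists>n\<le>t x ! i. le r (d \<xi> n)"
    if ap: "approx p' (t x) H" "le r p'" and h: "i < length (t x)" "\<alpha> \<in> H" "\<xi> \<in> preds \<alpha>" "to_nat_on (preds \<alpha>) \<xi> = i"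
    for p' H i \<alpha> \<xi>
  proof -
    obtain n where n: "n \<le> t x ! i" "le p' (d \<xi> n)" using ap(1) h unfolding approx_def by blast
    have "le r (d \<xi> n)"
      by (rule quasiorder_on_trans[OF pre ap(2) n(2) r(1) _ d]) (use ap(1) preds_subset h(3) in \<open>auto simp: approx_def\<close>)
    then show ?thesis using n(1) by blast
  qed
  have "approx r (t x) (?F \<union> ?G)"
    unfolding approx_def
  proof (intro conjI allI impI ballI)
    show "card ((\<lambda>\<alpha>. \<alpha> \<inter> {..<t x ! i}) ` (?F \<union> ?G)) \<le> Suc i" if "i < length (t x)" for i
      using ax that lv_i[OF that] unfolding approx_def by simp
    show "\<exists>n\<le>t x ! i. le r (d \<xi> n)"
      if "i < length (t x)" "\<alpha> \<in> ?F \<union> ?G" "\<xi> \<in> preds \<alpha>" "to_nat_on (preds \<alpha>) \<xi> = i" for i \<alpha> \<xi>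
      using mono[OF ax r(2) that(1) _ that(3,4)] mono[OF ay r(3) that(1) _ that(3,4)] that(2) by blast
  qed (use ax ay r(1) in \<open>auto simp: approx_def\<close>)
  \<comment> \<open>The factor 2 is used here: each of the two sets has at most half of
    \<open>length (t x)\<close> elements.\<close>
  moreover have "card (?F \<union> ?G) \<le> length (t x)"
    using card_Un_le[of ?F ?G] pt(4)[OF xy(1)] pt(4)[OF xy(2)] t_eq by simp
  ultimately have z: "(r, t x, ?F \<union> ?G) \<in> Q" by (simp add: Q_def)
  have "fst x \<in> P" "fst y \<in> P" using xy(1,2) A by (auto simp: Q_def approx_def)
  moreover have "p x \<in> P" "p y \<in> P" using ax ay by (auto simp: approx_def)
  ultimately have "le r (fst x)" "le r (fst y)"
    using quasiorder_on_trans[OF pre r(2) pt(2)[OF xy(1)] r(1)]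
      quasiorder_on_trans[OF pre r(3) pt(2)[OF xy(2)] r(1)] by blast+
  then have "leQ (r, t x, ?F \<union> ?G) x" "leQ (r, t x, ?F \<union> ?G) y"
    using pt(3)[OF xy(1)] pt(3)[OF xy(2)] t_eq by (auto simp: leQ_def split: prod.splits)
  then have "compatible Q leQ x y" using z unfolding compatible_def by blast
  then show False using inc xy(1,2,4) by blast
qed

lemma singleton_conditions:
  obtains p t where "\<And>\<alpha>. \<alpha> \<in> omega1 \<Longrightarrow> (p \<alpha>, t \<alpha>, {\<alpha>}) \<in> Q"
proof -
  have "\<exists>p t. (p, t, {\<alpha>}) \<in> Q" if "\<alpha> \<in> omega1" for \<alpha>
  proof -
    obtain p0 where "p0 \<in> P" using P_ne by blast
    \<comment> \<open>For the empty sequence the requirements on entries are vacuous; one extension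
      gives the length 1 that \<open>Q\<close> requires of a singleton.\<close>
    then have "approx p0 [] {\<alpha>}" using that by (simp add: approx_def)
    then obtain p k where "approx p [k] {\<alpha>}" using approx_extend[of p0 "[]" "{\<alpha>}"] by auto
    then have "(p, [k], {\<alpha>}) \<in> Q" by (simp add: Q_def)
    then show ?thesis by blast
  qed
  then show ?thesis using that by metis
qed

text \<open>An upper bound for the entries of a common refinement comes from the slalom condition: once
  \<open>i + 2\<close> elements of \<open>A\<close> are pairwise distinct below \<open>h i\<close>, any condition containing them has
  \<open>t ! i < h i\<close>.\<close>

lemma centered_imp_choice:
  assumes A: "A \<subseteq> omega1" "uncountable A"
    and cent: "\<And>F. finite F \<Longrightarrow> F \<subseteq> A \<Longrightarrow> \<exists>p t F'. (p, t, F') \<in> Q \<and> F \<subseteq> F'"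
  obtains m where "\<And>Z. finite Z \<Longrightarrow> Z \<subseteq> omega1 \<Longrightarrow> \<exists>p\<in>P. \<forall>\<xi>\<in>Z. le p (d \<xi> (m \<xi>))"
proof -
  have "\<exists>F n. finite F \<and> F \<subseteq> A \<and> card F = Suc (Suc i) \<and> inj_on (\<lambda>\<alpha>. \<alpha> \<inter> {..<n}) F" for i
  proof -
    have "infinite A" using A(2) countable_finite by blast
    then obtain F where "finite F" "F \<subseteq> A" "card F = Suc (Suc i)"
      using infinite_arbitrarily_large[of A "Suc (Suc i)"] by blast
    then show ?thesis using finite_separating_level[of F] by metis
  qed
  then obtain E h where E: "\<And>i. finite (E i)" "\<And>i. E i \<subseteq> A" "\<And>i. card (E i) = Suc (Suc i)"
    "\<And>i. inj_on (\<lambda>\<alpha>. \<alpha> \<inter> {..<h i :: nat}) (E i)" by metis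
  have "\<exists>\<alpha>\<in>A. \<xi> \<in> preds \<alpha>" if "\<xi> \<in> omega1" for \<xi>
  proof (rule ccontr)
    assume "\<not> ?thesis"
    then have "A \<subseteq> {\<alpha>\<in>omega1. \<xi> \<notin> preds \<alpha>}" using A(1) by blast
    then show False using countable_nonsuccessors[OF that] A(2) countable_subset by blast
  qed
  then obtain s where s: "\<And>\<xi>. \<xi> \<in> omega1 \<Longrightarrow> s \<xi> \<in> A" "\<And>\<xi>. \<xi> \<in> omega1 \<Longrightarrow> \<xi> \<in> preds (s \<xi>)" by metis
  \<comment> \<open>The place of \<open>\<xi>\<close> among the predecessors of
    \<open>s \<xi>\<close>: in a condition containing \<open>s \<xi>\<close>, the entry there, if
    present, bounds the index of a decision about \<open>\<xi>\<close>.\<close>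
  define idx where "idx \<xi> = to_nat_on (preds (s \<xi>)) \<xi>" for \<xi>
  have step: "\<exists>m. (\<forall>\<xi>\<in>Z. m \<xi> \<le> h (idx \<xi>)) \<and> (\<exists>p\<in>P. \<forall>\<xi>\<in>Z. le p (d \<xi> (m \<xi>)))"
    if Z: "finite Z" "Z \<subseteq> omega1" for Z
  proof -
    \<comment> \<open>The sets \<open>E (idx \<xi>)\<close> force the entries at these places to
      exist and to be small; the points \<open>s \<xi>\<close> make the condition decide
      \<open>\<xi>\<close>.\<close>
    let ?F = "s ` Z \<union> (\<Union>\<xi>\<in>Z. E (idx \<xi>))"
    have "finite ?F" using Z(1) E(1) by simp
    moreover have "?F \<subseteq> A" using Z(2) E(2) s(1) by (intro Un_least UN_least image_subsetI) auto
    ultimately have "\<exists>p t F'. (p, t, F') \<in> Q \<and> ?F \<subseteq> F'" by (rule cent)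
    then obtain p t F' where q: "(p, t, F') \<in> Q" "?F \<subseteq> F'" by blast
    then have ap: "approx p t F'" and c: "card F' \<le> length t" by (auto simp: Q_def)
    have "\<exists>n\<le>h (idx \<xi>). le p (d \<xi> n)" if \<xi>: "\<xi> \<in> Z" for \<xi>
    proof -
      let ?i = "idx \<xi>"
      have F': "finite F'" using ap by (simp add: approx_def)
      have EF: "E ?i \<subseteq> F'" using q(2) \<xi> by blast
      then have "Suc (Suc ?i) \<le> card F'" using card_mono[OF F'] E(3) by metis
      then have i: "?i < length t" using c by simp
      have "t ! ?i < h ?i"
      proof (rule ccontr)
        assume "\<not> t ! ?i < h ?i"
        then have lt: "{..<t ! ?i} \<inter> {..<h ?i} = {..<h ?i}" by auto
        have "inj_on (\<lambda>\<alpha>. \<alpha> \<inter> {..<t ! ?i}) (E ?i)"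
        proof (rule inj_onI)
          fix \<alpha> \<beta> assume ab: "\<alpha> \<in> E ?i" "\<beta> \<in> E ?i" "\<alpha> \<inter> {..<t ! ?i} = \<beta> \<inter> {..<t ! ?i}"
          have "\<alpha> \<inter> {..<h ?i} = \<beta> \<inter> {..<h ?i}" using ab(3) lt by (metis Int_assoc)
          then show "\<alpha> = \<beta>" using inj_onD[OF E(4)] ab(1,2) by blast
        qed
        then have "Suc (Suc ?i) = card ((\<lambda>\<alpha>. \<alpha> \<inter> {..<t ! ?i}) ` E ?i)" using card_image E(3) by metis
        also have "\<dots> \<le> card ((\<lambda>\<alpha>. \<alpha> \<inter> {..<t ! ?i}) ` F')" using EF F' by (intro card_mono) auto
        also have "\<dots> \<le> Suc ?i" using ap i by (simp add: approx_def)
        finally show False by simp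
      qed
      moreover have "\<exists>n\<le>t ! ?i. le p (d \<xi> n)"
        using ap i q(2) \<xi> s(2) Z(2) unfolding approx_def idx_def by blast
      ultimately show ?thesis by (meson less_imp_le order_trans)
    qed
    then obtain m where "\<forall>\<xi>\<in>Z. m \<xi> \<le> h (idx \<xi>) \<and> le p (d \<xi> (m \<xi>))" by metis
    then show ?thesis using ap unfolding approx_def by blast
  qed
  show ?thesis
  \<comment> \<open>The bound \<open>h (idx \<xi>)\<close> does not depend on \<open>Z\<close>, so
    the choices made for finite sets \<open>Z\<close> can be glued by compactness.\<close>
  proof (rule finite_choice_compactness[where I = omega1 and H = "\<lambda>\<xi>. h (idx \<xi>)"
        and G = "\<lambda>Z m. \<exists>p\<in>P. \<forall>\<xi>\<in>Z. le p (d \<xi> (m \<xi>))"])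
    fix m assume "\<And>Z. finite Z \<Longrightarrow> Z \<subseteq> omega1 \<Longrightarrow> \<exists>p\<in>P. \<forall>\<xi>\<in>Z. le p (d \<xi> (m \<xi>))"
    then show thesis by (rule that)
  next
    fix Z assume "finite Z" "Z \<subseteq> omega1"
    then show "\<exists>m. (\<forall>\<xi>\<in>Z. m \<xi> \<le> h (idx \<xi>)) \<and> (\<exists>p\<in>P. \<forall>\<xi>\<in>Z. le p (d \<xi> (m \<xi>)))"
      by (rule step)
  next
    fix Z :: "nat set set" and m m' :: "nat set \<Rightarrow> nat"
    assume "\<exists>p\<in>P. \<forall>\<xi>\<in>Z. le p (d \<xi> (m \<xi>))" "\<And>z. z \<in> Z \<Longrightarrow> m' z = m z"
    then show "\<exists>p\<in>P. \<forall>\<xi>\<in>Z. le p (d \<xi> (m' \<xi>))" by simp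
  next
    fix Z Z' :: "nat set set" and m :: "nat set \<Rightarrow> nat"
    assume "\<exists>p\<in>P. \<forall>\<xi>\<in>Z. le p (d \<xi> (m \<xi>))" "Z' \<subseteq> Z"
    then show "\<exists>p\<in>P. \<forall>\<xi>\<in>Z'. le p (d \<xi> (m \<xi>))" by blast
  qed
qed

end

section \<open>The Corson compactum of an adequate family\<close>

lemma open_fun_finite_nbhd:
  fixes f :: "'i \<Rightarrow> 'b::topological_space"
  assumes "open U" "f \<in> U"
  obtains Z where "finite Z" "\<And>g. (\<And>z. z \<in> Z \<Longrightarrow> g z = f z) \<Longrightarrow> g \<in> U"
proof -
  have "openin (product_topology (\<lambda>i::'i. euclidean) UNIV) U"
    using assms(1) by (simp add: euclidean_product_topology)
  then obtain X where X: "f \<in> Pi\<^sub>E UNIV X" "finite {i. X i \<noteq> UNIV}" "Pi\<^sub>E UNIV X \<subseteq> U"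
    using product_topology_open_contains_basis[of "\<lambda>i. euclidean" UNIV U f] assms(2)
    by (metis topspace_euclidean)
  show ?thesis
  proof (rule that[OF X(2)])
    fix g assume "\<And>z. z \<in> {i. X i \<noteq> UNIV} \<Longrightarrow> g z = f z"
    then have "g z \<in> X z" for z using X(1) by (cases "X z = UNIV") (auto simp: PiE_iff)
    then show "g \<in> U" using X(3) by auto
  qed
qed

text \<open>Finite unions of members of a countable base suffice. In the ccc proof this sorts
  uncountably many pairs of disjoint finite sets into countably many classes.\<close>

lemma countable_separation_real:
  obtains \<O> :: "real set set" where "countable \<O>"
    "\<And>F E. finite F \<Longrightarrow> finite E \<Longrightarrow> F \<inter> E = {} \<Longrightarrow> \<exists>V\<in>\<O>. F \<subseteq> V \<and> E \<inter> V = {}"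
proof -
  obtain B :: "real set set" where B: "countable B" "topological_basis B"
    using ex_countable_basis by blast
  show ?thesis
  proof (rule that[of "Union ` {S. finite S \<and> S \<subseteq> B}"])
    show "countable (Union ` {S. finite S \<and> S \<subseteq> B})"
      by (intro countable_image countable_Collect_finite_subset B(1))
    fix F E :: "real set" assume FE: "finite F" "finite E" "F \<inter> E = {}"
    have "\<exists>b\<in>B. x \<in> b \<and> b \<subseteq> - E" if x: "x \<in> F" for x
    proof -
      have "open (- E)" "x \<in> - E" using FE x finite_imp_closed[of E] by auto
      then obtain b where "b \<in> B" "x \<in> b" "b \<subseteq> - E" by (rule topological_basisE[OF B(2)])
      then show ?thesis by blast
    qed
    then obtain b where "\<And>x. x \<in> F \<Longrightarrow> b x \<in> B \<and> x \<in> b x \<and> b x \<subseteq> - E" by metis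
    then show "\<exists>V\<in>Union ` {S. finite S \<and> S \<subseteq> B}. F \<subseteq> V \<and> E \<inter> V = {}"
      using FE(1) by (intro bexI[of _ "\<Union>(b ` F)"] imageI) auto
  qed
qed

text \<open>What the topology needs from the bounded finite sets: \<open>good_countable\<close>
  makes supports countable, \<open>good_ccc\<close> gives ccc, \<open>good_insert\<close> provides
  uncountably many fresh coordinates, and the members of \<open>\<C>\<close> bound all supports. The
  index type in \<open>good_ccc\<close> is that of sets of points, since it is applied to families
  of open sets.\<close>

locale good_family =
  fixes good :: "real set \<Rightarrow> bool" and \<C> :: "real set set"
  assumes good_finite: "good F \<Longrightarrow> finite F"
    and good_empty: "good {}"
    and good_subset: "good F \<Longrightarrow> G \<subseteq> F \<Longrightarrow> good G"
    and good_insert: "good F \<Longrightarrow> uncountable {\<beta>. good (insert \<beta> F)}"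
    and good_countable: "(\<And>F. finite F \<Longrightarrow> F \<subseteq> A \<Longrightarrow> good F) \<Longrightarrow> countable A"
    and good_ccc: "uncountable (S :: (real \<Rightarrow> real) set set) \<Longrightarrow> (\<And>i. i \<in> S \<Longrightarrow> good (f i)) \<Longrightarrow>
          \<exists>i\<in>S. \<exists>j\<in>S. i \<noteq> j \<and> good (f i \<union> f j)"
    and \<C>_aleph1: "at_most_aleph1 \<C>" and \<C>_countable: "C \<in> \<C> \<Longrightarrow> countable C"
    and \<C>_cover: "countable A \<Longrightarrow> (\<And>\<beta>. \<beta> \<in> A \<Longrightarrow> good {\<beta>}) \<Longrightarrow> \<exists>C\<in>\<C>. A \<subseteq> C"
begin

text \<open>An adequate family in the sense of Talagrand: membership depends on finite subsets only,
  which makes it closed in the Cantor cube.\<close>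

definition K :: "real set \<Rightarrow> bool" where
  "K A \<longleftrightarrow> (\<forall>F. finite F \<longrightarrow> F \<subseteq> A \<longrightarrow> good F)"

text \<open>Sets are coded by real-valued characteristic functions, so that the embedding into the
  Sigma-product is the identity.\<close>

definition S :: "(real \<Rightarrow> real) set" where
  "S = {indicator A |A. K A}"

abbreviation X :: "(real \<Rightarrow> real) topology" where
  "X \<equiv> top_of_set S"

lemma good_imp_K: "good F \<Longrightarrow> K F"
  unfolding K_def using good_subset by blast

lemma K_countable: "K A \<Longrightarrow> countable A"
  unfolding K_def by (rule good_countable) blast

lemma support_indicator: "{z. indicator A z \<noteq> (0::real)} = A"
  by (auto simp: indicator_def)

lemma support_countable: "f \<in> S \<Longrightarrow> countable {z. f z \<noteq> 0}"
  unfolding S_def by (auto simp: support_indicator K_countable simp del: indicator_eq_0_iff)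

lemma closed_coordinate: "closed V \<Longrightarrow> closed {f :: real \<Rightarrow> real. f z \<in> V}"
  using closed_vimage[of V "\<lambda>f. f z"] continuous_on_product_coordinates
  by (simp add: vimage_def)

lemma compact_S: "compact S"
proof -
  \<comment> \<open>Each finite set that is not good forces one of its coordinates to vanish, which
    is a closed condition on the cube.\<close>
  have S_eq: "S = (\<Inter>F\<in>{F. finite F \<and> \<not> good F}. \<Union>z\<in>F. {f. f z \<in> {0}}) \<inter> Pi\<^sub>E UNIV (\<lambda>_. {0, 1})"
    (is "_ = ?R")
  proof
    show "S \<subseteq> ?R" unfolding S_def K_def by (auto simp: indicator_def)
    show "?R \<subseteq> S"
    proof
      fix f assume f: "f \<in> ?R"
      have f01: "f z = 0 \<or> f z = 1" for z using f by auto
      have "K {z. f z = 1}" unfolding K_def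
      proof (intro allI impI, rule ccontr)
        fix F assume F: "finite F" "F \<subseteq> {z. f z = 1}" "\<not> good F"
        then have "\<exists>z\<in>F. f z = 0" using f by auto
        then show False using F(2) by auto
      qed
      moreover have "f = indicator {z. f z = 1}" by (intro ext) (use f01 in \<open>auto simp: indicator_def\<close>)
      ultimately show "f \<in> S" unfolding S_def by blast
    qed
  qed
  have "compact (Pi\<^sub>E UNIV (\<lambda>_. {0, 1}) :: (real \<Rightarrow> real) set)" by (rule compact_PiE_UNIV) simp
  moreover have "closed (\<Inter>F\<in>{F. finite F \<and> \<not> good F}. \<Union>z\<in>F. {f :: real \<Rightarrow> real. f z \<in> {0}})"
    by (intro closed_INT ballI closed_UN closed_coordinate) auto
  ultimately show ?thesis unfolding S_eq by (rule closed_Int_compact[rotated])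
qed

lemma compact_space_X: "compact_space X"
  using compact_S by (simp add: compact_space_subtopology)

lemma Hausdorff_space_X: "Hausdorff_space X"
proof -
  have "Hausdorff_space (powertop_real (UNIV :: real set))"
    by (simp add: Hausdorff_space_product_topology)
  then show ?thesis by (simp add: euclidean_product_topology Hausdorff_space_subtopology)
qed

lemma corson_X: "corson_compactum TYPE(real) X"
proof -
  have "S \<subseteq> Sigma_product" using support_countable by (auto simp: Sigma_product_def)
  then have "embedding_map X (subtopology (powertop_real UNIV) Sigma_product) id"
    by (simp add: embedding_map_def euclidean_product_topology subtopology_subtopology Int_absorb1)
  then show ?thesis using compact_space_X Hausdorff_space_X unfolding corson_compactum_def by blast
qed

text \<open>A neighbourhood of \<open>indicator A\<close> contains all points agreeing with it on
  some finite \<open>Z\<close>; this means including \<open>A \<inter> Z\<close> and excluding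
  \<open>Z - A\<close>.\<close>

lemma basic_nbhd:
  assumes "openin X U" "f \<in> U"
  obtains F E where "good F" "finite E" "F \<inter> E = {}"
    "\<And>B. K B \<Longrightarrow> F \<subseteq> B \<Longrightarrow> E \<inter> B = {} \<Longrightarrow> indicator B \<in> U"
proof -
  obtain V where V: "open V" "U = S \<inter> V" using assms(1) by (auto simp: openin_open)
  then obtain A where A: "f = indicator A" "K A" using assms(2) unfolding S_def by blast
  obtain Z where Z: "finite Z" "\<And>g. (\<And>z. z \<in> Z \<Longrightarrow> g z = f z) \<Longrightarrow> g \<in> V"
    using open_fun_finite_nbhd[OF V(1)] assms(2) V(2) by blast
  show ?thesis
  proof (rule that[of "A \<inter> Z" "Z - A"])
    show "good (A \<inter> Z)" using A(2) Z(1) unfolding K_def by blast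
    fix B assume B: "K B" "A \<inter> Z \<subseteq> B" "(Z - A) \<inter> B = {}"
    have "indicator B \<in> V" by (rule Z(2)) (use B(2,3) in \<open>auto simp: A(1) indicator_def\<close>)
    then show "indicator B \<in> U" using B(1) V(2) unfolding S_def by blast
  qed (use Z(1) in auto)
qed

text \<open>Uncountably many of the open sets share one set \<open>W\<close> from a countable list
  that contains \<open>F U\<close> and misses \<open>E U\<close>. Among these, the positive part of
  one never meets the negative part of another, so \<open>good_ccc\<close> yields a point common to
  two of them.\<close>

lemma ccc_X: "ccc_space X"
  unfolding ccc_space_def
proof (intro allI impI, rule ccontr, elim conjE)
  fix \<U> assume ne: "\<forall>U\<in>\<U>. openin X U \<and> U \<noteq> {}" and disj: "pairwise disjnt \<U>" and unc: "uncountable \<U>"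
  have "\<exists>F E. good F \<and> finite E \<and> F \<inter> E = {} \<and>
      (\<forall>B. K B \<longrightarrow> F \<subseteq> B \<longrightarrow> E \<inter> B = {} \<longrightarrow> indicator B \<in> U)" if U: "U \<in> \<U>" for U
  proof -
    obtain f where "openin X U" "f \<in> U" using ne U by blast
    then show ?thesis by (rule basic_nbhd) blast
  qed
  then obtain F E where FE: "\<And>U. U \<in> \<U> \<Longrightarrow> good (F U)" "\<And>U. U \<in> \<U> \<Longrightarrow> finite (E U)"
    "\<And>U. U \<in> \<U> \<Longrightarrow> F U \<inter> E U = {}"
    "\<And>U B. U \<in> \<U> \<Longrightarrow> K B \<Longrightarrow> F U \<subseteq> B \<Longrightarrow> E U \<inter> B = {} \<Longrightarrow> indicator B \<in> U"
    by metis
  obtain \<O> :: "real set set" where \<O>: "countable \<O>"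
    "\<And>F E. finite F \<Longrightarrow> finite E \<Longrightarrow> F \<inter> E = {} \<Longrightarrow> \<exists>V\<in>\<O>. F \<subseteq> V \<and> E \<inter> V = {}"
    using countable_separation_real by metis
  have "\<exists>V\<in>\<O>. F U \<subseteq> V \<and> E U \<inter> V = {}" if "U \<in> \<U>" for U
    by (rule \<O>(2)) (use FE that good_finite in auto)
  then obtain V where V: "\<And>U. U \<in> \<U> \<Longrightarrow> V U \<in> \<O>" "\<And>U. U \<in> \<U> \<Longrightarrow> F U \<subseteq> V U"
    "\<And>U. U \<in> \<U> \<Longrightarrow> E U \<inter> V U = {}" by metis
  have "V ` \<U> \<subseteq> \<O>" using V(1) by blast
  then obtain W where W: "uncountable {U\<in>\<U>. V U = W}"
    by (rule uncountable_fiber[OF unc \<O>(1)])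
  obtain U U' where UU: "U \<in> \<U>" "U' \<in> \<U>" "V U = W" "V U' = W" "U \<noteq> U'" "good (F U \<union> F U')"
    using good_ccc[OF W, of F] FE(1) by blast
  have "E U \<inter> (F U \<union> F U') = {}" "E U' \<inter> (F U \<union> F U') = {}"
    using V(2,3)[OF UU(1)] V(2,3)[OF UU(2)] UU(3,4) by auto
  then have "indicator (F U \<union> F U') \<in> U \<inter> U'"
    using FE(4)[OF UU(1) good_imp_K[OF UU(6)]] FE(4)[OF UU(2) good_imp_K[OF UU(6)]] by blast
  then show False using disj UU(1,2,5) unfolding pairwise_def disjnt_def by blast
qed

lemma openin_support: "openin X {f\<in>S. f \<beta> \<noteq> 0}"
proof -
  have "closedin X (S \<inter> {f. f \<beta> \<in> {0}})"
    by (intro closedin_closed_Int closed_coordinate) simp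
  then have "openin X (S - S \<inter> {f. f \<beta> \<in> {0}})" by (simp add: closedin_def)
  moreover have "S - S \<inter> {f. f \<beta> \<in> {0}} = {f\<in>S. f \<beta> \<noteq> 0}" by auto
  ultimately show ?thesis by simp
qed

text \<open>In essence, a dense metrizable subspace of a ccc space is separable, and countably many
  countable supports cannot exhaust the uncountably many coordinates. The argument works at a single
  scale \<open>\<epsilon>\<close>.\<close>

lemma no_dense_metrizable_X: "\<not> has_dense_metrizable_subspace X"
proof
  assume "has_dense_metrizable_subspace X"
  then obtain D where D: "D \<subseteq> S" "X closure_of D = topspace X" "metrizable_space (subtopology X D)"
    unfolding has_dense_metrizable_subspace_def by auto
  have dense: "D \<inter> T \<noteq> {}" if "openin X T" "T \<noteq> {}" for T
    using D(2) that unfolding dense_intersects_open by blast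
  obtain M d where M: "Metric_space M d" "subtopology X D = Metric_space.mtopology M d"
    using D(3) unfolding metrizable_space_def by blast
  interpret Metric_space M d by (rule M(1))
  have MD: "M = D" using arg_cong[OF M(2), of topspace] D(1) by auto
  let ?J = "{\<beta>. good {\<beta>}}"
  have "\<exists>x n. x \<in> D \<and> x \<beta> \<noteq> 0 \<and> (\<forall>y\<in>mball x (1 / Suc n). y \<beta> \<noteq> 0)" if \<beta>: "good {\<beta>}" for \<beta>
  proof -
    have "indicator {\<beta>} \<in> {f\<in>S. f \<beta> \<noteq> 0}" using good_imp_K[OF \<beta>] unfolding S_def by auto
    then obtain x where x: "x \<in> D" "x \<in> {f\<in>S. f \<beta> \<noteq> 0}"
      using dense[OF openin_support, of \<beta>] by blast
    have "openin mtopology ({f\<in>S. f \<beta> \<noteq> 0} \<inter> D)"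
      using openin_support[of \<beta>] unfolding M(2)[symmetric] by (rule openin_subtopology_Int)
    then obtain r where r: "r > 0" "mball x r \<subseteq> {f\<in>S. f \<beta> \<noteq> 0} \<inter> D"
      using x unfolding openin_mtopology by blast
    obtain n where n: "1 / Suc n < r" using r(1) nat_approx_posE by blast
    have "mball x (1 / Suc n) \<subseteq> mball x r" using n by (intro mball_subset_concentric) simp
    then show ?thesis using x r(2) by blast
  qed
  then obtain x n where x: "\<And>\<beta>. good {\<beta>} \<Longrightarrow> x \<beta> \<in> D" "\<And>\<beta>. good {\<beta>} \<Longrightarrow> x \<beta> \<beta> \<noteq> 0"
    "\<And>\<beta> y. good {\<beta>} \<Longrightarrow> y \<in> mball (x \<beta>) (1 / Suc (n \<beta>)) \<Longrightarrow> y \<beta> \<noteq> 0" by metis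
  have unc: "uncountable ?J" using good_insert[OF good_empty] by simp
  obtain k where k: "uncountable {\<beta>\<in>?J. n \<beta> = k}"
    by (rule uncountable_fiber[OF unc, of UNIV n]) auto
  define \<epsilon> where "\<epsilon> = 1 / real (Suc k)"
  let ?R = "\<lambda>\<beta> \<gamma>. \<epsilon> \<le> d (x \<beta>) (x \<gamma>)"
  \<comment> \<open>A maximal \<open>\<epsilon>\<close>-separated choice of indices. Every other
    index of the fibre lies in the support of a nearby \<open>x \<gamma>\<close> with
    \<open>\<gamma> \<in> N\<close>, so a countable \<open>N\<close> would make the fibre
    countable.\<close>
  obtain N where N: "N \<subseteq> {\<beta>\<in>?J. n \<beta> = k}" "pairwise ?R N"
    "\<And>\<beta>. \<beta> \<in> {\<beta>\<in>?J. n \<beta> = k} - N \<Longrightarrow> \<exists>\<gamma>\<in>N. \<not> (?R \<beta> \<gamma> \<and> ?R \<gamma> \<beta>)"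
    using maximal_pairwise[of "{\<beta>\<in>?J. n \<beta> = k}" ?R] by blast
  have "{\<beta>\<in>?J. n \<beta> = k} \<subseteq> (\<Union>\<gamma>\<in>N. {z. x \<gamma> z \<noteq> 0})"
  proof
    fix \<beta> assume \<beta>: "\<beta> \<in> {\<beta>\<in>?J. n \<beta> = k}"
    show "\<beta> \<in> (\<Union>\<gamma>\<in>N. {z. x \<gamma> z \<noteq> 0})"
    proof (cases "\<beta> \<in> N")
      case False
      then have "\<beta> \<in> {\<beta>\<in>?J. n \<beta> = k} - N" using \<beta> by blast
      then obtain \<gamma> where "\<gamma> \<in> N" "\<not> (?R \<beta> \<gamma> \<and> ?R \<gamma> \<beta>)" using N(3) by blast
      then have \<gamma>: "\<gamma> \<in> N" "d (x \<beta>) (x \<gamma>) < \<epsilon>"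
        using commute[of "x \<beta>" "x \<gamma>"] by auto
      have "x \<gamma> \<in> mball (x \<beta>) (1 / Suc (n \<beta>))"
        using \<gamma> \<beta> N(1) x(1) MD unfolding in_mball \<epsilon>_def by auto
      then show ?thesis using x(3) \<beta> \<gamma>(1) by blast
    qed (use x(2) \<beta> in auto)
  qed
  moreover have "countable {z. x \<gamma> z \<noteq> 0}" if "\<gamma> \<in> N" for \<gamma>
    using support_countable x(1) N(1) D(1) that by blast
  ultimately have uncN: "uncountable N" using k countable_subset countable_UN by meson
  \<comment> \<open>Open sets of the whole space whose traces on \<open>D\<close> are the
    half-radius balls. They are disjoint for distinct indices in \<open>N\<close>, since an overlap
    would meet the dense set \<open>D\<close>.\<close>
  have "\<exists>T. openin X T \<and> mball (x \<beta>) (\<epsilon> / 2) = T \<inter> D" for \<beta>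
    using openin_mball[of "x \<beta>" "\<epsilon> / 2"] unfolding M(2)[symmetric] openin_subtopology .
  then obtain T where T: "\<And>\<beta>. openin X (T \<beta>)" "\<And>\<beta>. mball (x \<beta>) (\<epsilon> / 2) = T \<beta> \<inter> D" by metis
  have xT: "x \<beta> \<in> T \<beta>" if "\<beta> \<in> N" for \<beta>
  proof -
    have "x \<beta> \<in> mball (x \<beta>) (\<epsilon> / 2)"
      using x(1) that N(1) MD by (subst centre_in_mball_iff) (auto simp: \<epsilon>_def)
    then show ?thesis using T(2) by blast
  qed
  have T_disj: "T \<beta> \<inter> T \<gamma> = {}" if bc: "\<beta> \<in> N" "\<gamma> \<in> N" "\<beta> \<noteq> \<gamma>" for \<beta> \<gamma>
  proof (rule ccontr)
    assume "T \<beta> \<inter> T \<gamma> \<noteq> {}"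
    then obtain y where "y \<in> D \<inter> (T \<beta> \<inter> T \<gamma>)"
      using dense[of "T \<beta> \<inter> T \<gamma>"] T(1) openin_Int by blast
    then have "y \<in> mball (x \<beta>) (\<epsilon> / 2)" "y \<in> mball (x \<gamma>) (\<epsilon> / 2)" using T(2) by blast+
    then have "d (x \<beta>) (x \<gamma>) < \<epsilon>"
      using triangle[of "x \<beta>" y "x \<gamma>"] commute[of y] by (auto simp: in_mball)
    then show False using N(2) bc unfolding pairwise_def by fastforce
  qed
  have "inj_on T N" using T_disj xT by (metis (no_types, lifting) IntI empty_iff inj_onI)
  moreover have "countable (T ` N)"
  proof -
    have "\<forall>U\<in>T ` N. openin X U \<and> U \<noteq> {}" using T(1) xT by blast
    moreover have "pairwise disjnt (T ` N)"
      using T_disj unfolding pairwise_def disjnt_def by blast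
    ultimately show ?thesis using ccc_X unfolding ccc_space_def by blast
  qed
  ultimately show False using uncN countable_image_inj_on by blast
qed

text \<open>The set is closed. In a basic neighbourhood with positive part \<open>F\<close>, one of
  the uncountably many coordinates from \<open>good_insert\<close> avoids both \<open>C\<close> and
  the finite negative part \<open>E\<close>, and adding it leaves the set.\<close>

lemma nowhere_dense_bounded_support:
  assumes C: "countable C" shows "nowhere_dense_in X {f\<in>S. {z. f z \<noteq> 0} \<subseteq> C}" (is "nowhere_dense_in X ?N")
proof -
  have "?N = S \<inter> (\<Inter>z\<in>- C. {f. f z \<in> {0}})" by auto
  moreover have "closedin X (S \<inter> (\<Inter>z\<in>- C. {f. f z \<in> {0}}))"
    by (intro closedin_closed_Int closed_INT ballI closed_coordinate) simp
  ultimately have cl: "closedin X ?N" by simp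
  have "X interior_of ?N = {}"
  proof (rule ccontr)
    assume "X interior_of ?N \<noteq> {}"
    then obtain f where f: "f \<in> X interior_of ?N" by blast
    obtain F E where FE: "good F" "finite E" "F \<inter> E = {}"
      "\<And>B. K B \<Longrightarrow> F \<subseteq> B \<Longrightarrow> E \<inter> B = {} \<Longrightarrow> indicator B \<in> X interior_of ?N"
      using basic_nbhd[OF openin_interior_of f] by blast
    have "uncountable ({\<beta>. good (insert \<beta> F)} - (C \<union> E))"
      by (intro uncountable_minus_countable good_insert FE(1)) (simp add: C FE(2) countable_finite)
    then have "{\<beta>. good (insert \<beta> F)} - (C \<union> E) \<noteq> {}" by fastforce
    then obtain \<beta> where \<beta>: "good (insert \<beta> F)" "\<beta> \<notin> C" "\<beta> \<notin> E" by blast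
    then have "indicator (insert \<beta> F) \<in> X interior_of ?N"
      using FE(3) by (intro FE(4) good_imp_K) auto
    then have "indicator (insert \<beta> F) \<in> ?N" by (rule subsetD[OF interior_of_subset])
    then have "insert \<beta> F \<subseteq> C" unfolding mem_Collect_eq support_indicator by (rule conjunct2)
    then show False using \<beta>(2) by blast
  qed
  then show ?thesis using cl unfolding nowhere_dense_in_def by (auto simp: closure_of_closedin)
qed

lemma statements: "statement1 TYPE(real \<Rightarrow> real) TYPE(real) \<and> statement2 TYPE(real \<Rightarrow> real)"
proof
  show "statement1 TYPE(real \<Rightarrow> real) TYPE(real)"
    unfolding statement1_def using corson_X ccc_X no_dense_metrizable_X by blast
  let ?N = "\<lambda>C. {f\<in>S. {z. f z \<noteq> 0} \<subseteq> C}"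
  have "S \<subseteq> \<Union>(?N ` \<C>)"
  proof
    fix f assume f: "f \<in> S"
    then obtain A where A: "f = indicator A" "K A" unfolding S_def by blast
    have "\<exists>C\<in>\<C>. A \<subseteq> C"
      by (rule \<C>_cover[OF K_countable[OF A(2)]]) (use A(2) in \<open>simp add: K_def\<close>)
    then show "f \<in> \<Union>(?N ` \<C>)" using f by (auto simp: A(1) support_indicator simp del: indicator_eq_0_iff)
  qed
  then have "\<Union>(?N ` \<C>) = topspace X" by auto
  moreover have "\<forall>N\<in>?N ` \<C>. nowhere_dense_in X N"
    using nowhere_dense_bounded_support \<C>_countable by blast
  moreover have "at_most_aleph1 (?N ` \<C>)" by (rule at_most_aleph1_image[OF \<C>_aleph1])
  moreover have "topspace X \<noteq> {}" using good_imp_K[OF good_empty] unfolding S_def by auto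
  ultimately show "statement2 TYPE(real \<Rightarrow> real)"
    unfolding statement2_def using compact_space_X Hausdorff_space_X ccc_X by blast
qed

end

section \<open>Consequences of MA for compact ccc spaces\<close>

definition opens_below :: "'a topology \<Rightarrow> 'a set \<Rightarrow> 'a set set" where
  "opens_below X W = {U. openin X U \<and> U \<noteq> {} \<and> U \<subseteq> W}"

lemma poset_on_subset: "poset_on P (\<subseteq>)"
  unfolding poset_on_def by blast

lemma compatible_opens_below:
  assumes "U \<in> opens_below X W" "openin X V"
  shows "compatible (opens_below X W) (\<subseteq>) U V \<longleftrightarrow> U \<inter> V \<noteq> {}"
proof
  assume "U \<inter> V \<noteq> {}"
  then have "U \<inter> V \<in> opens_below X W" using assms openin_Int unfolding opens_below_def by blast
  then show "compatible (opens_below X W) (\<subseteq>) U V" unfolding compatible_def by blast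
qed (auto simp: compatible_def opens_below_def)

lemma ccc_poset_opens_below:
  assumes "ccc_space X" shows "ccc_poset (opens_below X W) (\<subseteq>)"
proof (rule ccc_posetI)
  fix A assume A: "A \<subseteq> opens_below X W"
    and inc: "\<And>p q. p \<in> A \<Longrightarrow> q \<in> A \<Longrightarrow> p \<noteq> q \<Longrightarrow> \<not> compatible (opens_below X W) (\<subseteq>) p q"
  have op: "openin X U \<and> U \<noteq> {}" if "U \<in> A" for U using A that unfolding opens_below_def by blast
  have "disjnt U V" if "U \<in> A" "V \<in> A" "U \<noteq> V" for U V
    using inc[OF that] compatible_opens_below[of U X W V] A op that unfolding disjnt_def by blast
  then have "pairwise disjnt A" by (rule pairwiseI)
  then show "countable A" using assms op unfolding ccc_space_def by blast
qed

text \<open>By directedness any finitely many members of \<open>G\<close> contain a common nonempty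
  member, so compactness applies to the closures.\<close>

lemma filter_closures_common_point:
  assumes X: "compact_space X" and G: "filter_on (opens_below X W) (\<subseteq>) G"
  obtains x where "x \<in> topspace X" "\<And>U. U \<in> G \<Longrightarrow> x \<in> X closure_of U"
proof -
  have G_op: "openin X U" "U \<noteq> {}" if "U \<in> G" for U
    using G that unfolding filter_on_def opens_below_def by auto
  have G_ne: "G \<noteq> {}" using G unfolding filter_on_def by simp
  have G_dir: "\<exists>r\<in>G. r \<subseteq> p \<and> r \<subseteq> q" if "p \<in> G" "q \<in> G" for p q
    using G that unfolding filter_on_def by simp_all
  have lower: "\<exists>U\<in>G. \<forall>V\<in>\<V>. U \<subseteq> V" if "finite \<V>" "\<V> \<subseteq> G" for \<V>
    using that
  proof (induction \<V>)
    case empty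
    then show ?case using G_ne by blast
  next
    case (insert V \<V>)
    then obtain U where U: "U \<in> G" "\<forall>V\<in>\<V>. U \<subseteq> V" by blast
    have "\<exists>U'\<in>G. U' \<subseteq> U \<and> U' \<subseteq> V" using G_dir U(1) insert.prems by blast
    then obtain U' where "U' \<in> G" "U' \<subseteq> U" "U' \<subseteq> V" by blast
    then show ?case using U(2) by blast
  qed
  have "\<Inter>((closure_of) X ` G) \<noteq> {}"
  proof (rule compact_space_fip[THEN iffD1, rule_format, OF X], intro conjI ballI allI impI)
    fix \<F> assume "finite \<F> \<and> \<F> \<subseteq> (closure_of) X ` G"
    then obtain \<V> where \<V>: "finite \<V>" "\<V> \<subseteq> G" "\<F> = (closure_of) X ` \<V>"
      using finite_subset_image[of \<F>] by metis
    obtain U where U: "U \<in> G" "\<And>V. V \<in> \<V> \<Longrightarrow> U \<subseteq> V" using lower[OF \<V>(1,2)] by blast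
    have "U \<subseteq> X closure_of V" if "V \<in> \<V>" for V
      using closure_of_mono[OF U(2)[OF that], of X] closure_of_subset[OF openin_subset[OF G_op(1)[OF U(1)]]]
      by (rule order_trans[rotated])
    then have "U \<subseteq> \<Inter>\<F>" using \<V>(3) by blast
    then show "\<Inter>\<F> \<noteq> {}" using G_op(2)[OF U(1)] by blast
  qed auto
  then obtain x where x: "\<And>U. U \<in> G \<Longrightarrow> x \<in> X closure_of U" by blast
  obtain U where "U \<in> G" using G_ne by blast
  then have "x \<in> topspace X" using x closure_of_subset_topspace[of X U] by blast
  then show ?thesis using that x by blast
qed

lemma openin_shrink:
  assumes "compact_space X" "Hausdorff_space X" "openin X U" "U \<noteq> {}"
  obtains V where "openin X V" "V \<noteq> {}" "X closure_of V \<subseteq> U"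
proof -
  obtain x where x: "x \<in> U" using assms(4) by blast
  have "neighbourhood_base_of (closedin X) X"
    unfolding neighbourhood_base_of_closedin by (rule compact_Hausdorff_imp_regular_space[OF assms(1,2)])
  then obtain V C where V: "openin X V" "closedin X C" "x \<in> V" "V \<subseteq> C" "C \<subseteq> U"
    unfolding neighbourhood_base_of using assms(3) x by meson
  have "X closure_of V \<subseteq> U" using closure_of_minimal[OF V(4,2)] V(5) by (rule order_trans)
  then show ?thesis using that V(1,3) by blast
qed

text \<open>By regularity, the open sets whose closure misses that of \<open>N\<close> are dense. A
  filter meeting these dense sets for all \<open>N \<in> \<N>\<close> has a point in the closures of
  all its members, and this point lies outside the supposed cover.\<close>

lemma MA_omega1_imp_not_statement2:
  assumes MA: "MA_omega1 TYPE('b set)" shows "\<not> statement2 TYPE('b)"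
proof
  assume "statement2 TYPE('b)"
  then obtain X :: "'b topology" and \<N> where X: "compact_space X" "Hausdorff_space X" "ccc_space X" "topspace X \<noteq> {}"
    and \<N>: "at_most_aleph1 \<N>" "\<And>N. N \<in> \<N> \<Longrightarrow> nowhere_dense_in X N" "\<Union>\<N> = topspace X"
    unfolding statement2_def by blast
  let ?P = "opens_below X (topspace X)"
  define D where "D N = {U\<in>?P. X closure_of U \<inter> X closure_of N = {}}" for N
  have ne: "?P \<noteq> {}" using X(4) openin_topspace[of X] unfolding opens_below_def by blast
  have dense: "dense_in_poset ?P (\<subseteq>) (D N)" if N: "N \<in> \<N>" for N
    unfolding dense_in_poset_def
  proof (intro conjI ballI)
    fix U assume "U \<in> ?P"
    then have U: "openin X U" "U \<noteq> {}" by (auto simp: opens_below_def)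
    have "\<not> U \<subseteq> X closure_of N"
      using interior_of_maximal[of U "X closure_of N" X] U \<N>(2)[OF N] unfolding nowhere_dense_in_def by blast
    moreover have "openin X (U - X closure_of N)" using U(1) by (simp add: openin_diff)
    ultimately obtain V where V: "openin X V" "V \<noteq> {}" "X closure_of V \<subseteq> U - X closure_of N"
      using openin_shrink[OF X(1,2)] by blast
    have "V \<subseteq> X closure_of V" by (rule closure_of_subset[OF openin_subset[OF V(1)]])
    then have "V \<in> D N" "V \<subseteq> U" using V openin_subset[OF V(1)] unfolding D_def opens_below_def by blast+
    then show "\<exists>V\<in>D N. V \<subseteq> U" by blast
  qed (auto simp: D_def)
  obtain G where G: "filter_on ?P (\<subseteq>) G" "\<And>N. N \<in> \<N> \<Longrightarrow> G \<inter> D N \<noteq> {}"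
    using MA_omega1_filter[OF MA poset_on_subset ne ccc_poset_opens_below[OF X(3)] \<N>(1), of D, OF dense]
    by blast
  obtain x where x: "x \<in> topspace X" "\<And>U. U \<in> G \<Longrightarrow> x \<in> X closure_of U"
    using filter_closures_common_point[OF X(1) G(1)] by blast
  obtain N where N: "N \<in> \<N>" "x \<in> N" using x(1) \<N>(3) by blast
  obtain U where "U \<in> G" "X closure_of U \<inter> X closure_of N = {}" using G(2)[OF N(1)] unfolding D_def by blast
  moreover have "x \<in> X closure_of N"
    using closure_of_subset[of N X] \<N>(2)[OF N(1)] N(2) unfolding nowhere_dense_in_def by blast
  ultimately show False using x(2) by blast
qed

lemma preds_asym: "\<beta> \<in> preds \<alpha> \<Longrightarrow> \<alpha> \<notin> preds \<beta>"
proof -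
  have "antisym (cardSuc natLeq)"
    using Well_order_omega1 unfolding well_order_on_def linear_order_on_def partial_order_on_def by blast
  then show "\<beta> \<in> preds \<alpha> \<Longrightarrow> \<alpha> \<notin> preds \<beta>"
    unfolding preds_def underS_def antisym_def by blast
qed

lemma at_most_aleph1_omega1: "at_most_aleph1 omega1"
  unfolding at_most_aleph1_iff by (intro exI[of _ id]) simp

text \<open>Caliber omega_1, in a form with closures. Below a suitable \<open>W\<close> every
  nonempty open set meets \<open>V \<alpha>\<close> for cofinally many \<open>\<alpha>\<close>, so
  the open sets inside some \<open>V \<alpha>\<close> with \<open>\<alpha>\<close> beyond
  \<open>\<beta>\<close> are dense there. A filter meeting all these dense sets yields the
  point.\<close>

lemma MA_omega1_imp_caliber:
  fixes X :: "'b topology"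
  assumes MA: "MA_omega1 TYPE('b set)" and X: "compact_space X" "ccc_space X"
    and V: "\<And>\<alpha>. \<alpha> \<in> omega1 \<Longrightarrow> openin X (V \<alpha>)" "\<And>\<alpha>. \<alpha> \<in> omega1 \<Longrightarrow> V \<alpha> \<noteq> {}"
  obtains x where "x \<in> topspace X" "uncountable {\<alpha>\<in>omega1. x \<in> X closure_of V \<alpha>}"
proof -
  let ?P = "opens_below X (topspace X)"
  have VP: "V \<alpha> \<in> ?P" if "\<alpha> \<in> omega1" for \<alpha>
    using V that openin_subset unfolding opens_below_def by blast
  obtain W where W: "W \<in> ?P"
    "\<And>U. U \<in> ?P \<Longrightarrow> U \<subseteq> W \<Longrightarrow> uncountable {\<alpha>\<in>omega1. compatible ?P (\<subseteq>) U (V \<alpha>)}"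
    using ccc_poset_localize[where q = V, OF poset_on_imp_quasiorder_on[OF poset_on_subset]
        ccc_poset_opens_below[OF X(2)] VP uncountable_omega1]
    by blast
  let ?Q = "opens_below X W"
  define D where "D \<beta> = {U\<in>?Q. \<exists>\<alpha>\<in>omega1. \<beta> \<in> preds \<alpha> \<and> U \<subseteq> V \<alpha>}" for \<beta>
  have ne: "?Q \<noteq> {}" using W(1) unfolding opens_below_def by blast
  have dense: "dense_in_poset ?Q (\<subseteq>) (D \<beta>)" if \<beta>: "\<beta> \<in> omega1" for \<beta>
    unfolding dense_in_poset_def
  proof (intro conjI ballI)
    fix U assume "U \<in> ?Q"
    then have U: "openin X U" "U \<noteq> {}" "U \<subseteq> W" "U \<in> ?P"
      using W(1) unfolding opens_below_def by auto
    have "{\<alpha>\<in>omega1. compatible ?P (\<subseteq>) U (V \<alpha>)} - {\<alpha>\<in>omega1. \<beta> \<notin> preds \<alpha>} \<noteq> {}"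
      using uncountable_minus_countable[OF W(2)[OF U(4,3)] countable_nonsuccessors[OF \<beta>]] by fastforce
    then obtain \<alpha> where \<alpha>: "\<alpha> \<in> omega1" "compatible ?P (\<subseteq>) U (V \<alpha>)" "\<beta> \<in> preds \<alpha>" by blast
    then have "U \<inter> V \<alpha> \<noteq> {}" using compatible_opens_below[OF U(4) V(1)] by blast
    then have "U \<inter> V \<alpha> \<in> D \<beta>"
      using \<alpha> U(1,3) V(1) openin_Int unfolding D_def opens_below_def by blast
    then show "\<exists>U'\<in>D \<beta>. U' \<subseteq> U" by blast
  qed (auto simp: D_def)
  obtain G where G: "filter_on ?Q (\<subseteq>) G" "\<And>\<beta>. \<beta> \<in> omega1 \<Longrightarrow> G \<inter> D \<beta> \<noteq> {}"
    using MA_omega1_filter[OF MA poset_on_subset ne ccc_poset_opens_below[OF X(2)] at_most_aleph1_omega1, of D, OF dense]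
    by blast
  obtain x where x: "x \<in> topspace X" "\<And>U. U \<in> G \<Longrightarrow> x \<in> X closure_of U"
    using filter_closures_common_point[OF X(1) G(1)] by blast
  let ?T = "{\<alpha>\<in>omega1. x \<in> X closure_of V \<alpha>}"
  have cofinal: "\<exists>\<alpha>\<in>?T. \<beta> \<in> preds \<alpha>" if \<beta>: "\<beta> \<in> omega1" for \<beta>
  proof -
    obtain U \<alpha> where "U \<in> G" "\<alpha> \<in> omega1" "\<beta> \<in> preds \<alpha>" "U \<subseteq> V \<alpha>"
      using G(2)[OF \<beta>] unfolding D_def by blast
    then show ?thesis using x(2) closure_of_mono by blast
  qed
  have "uncountable ?T"
  proof
    assume "countable ?T"
    then obtain \<gamma> where "\<gamma> \<in> omega1" "?T \<subseteq> preds \<gamma>" by (rule omega1_bounds_countable) blast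
    then show False using cofinal preds_asym by blast
  qed
  then show ?thesis using that x(1) by blast
qed

text \<open>Restricting to \<open>B\<close> loses nothing, as the other coordinates vanish; a
  continuous injection of a compact space into the metrizable product over \<open>B\<close> is an
  embedding.\<close>

lemma metrizable_space_countably_many_coordinates:
  fixes f :: "'a \<Rightarrow> 'k \<Rightarrow> real"
  assumes X: "compact_space X" and f: "continuous_map X (powertop_real UNIV) f" "inj_on f (topspace X)"
    and B: "countable B" "\<And>x k. x \<in> topspace X \<Longrightarrow> k \<notin> B \<Longrightarrow> f x k = 0"
  shows "metrizable_space X"
proof -
  let ?Y = "product_topology (\<lambda>_. euclideanreal) B" and ?g = "\<lambda>x. restrict (f x) B"
  have "continuous_map X euclideanreal (\<lambda>x. f x k)" for k
    using f(1) unfolding continuous_map_componentwise_UNIV by blast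
  then have "continuous_map X ?Y ?g"
    unfolding continuous_map_componentwise by auto
  moreover have "inj_on ?g (topspace X)"
  proof (rule inj_onI)
    fix x y assume xy: "x \<in> topspace X" "y \<in> topspace X" "?g x = ?g y"
    have "f x k = f y k" for k
      using fun_cong[OF xy(3), of k] B(2)[OF xy(1), of k] B(2)[OF xy(2), of k] by (cases "k \<in> B") auto
    then show "x = y" using inj_onD[OF f(2)] xy(1,2) by blast
  qed
  moreover have "Hausdorff_space ?Y" by (simp add: Hausdorff_space_product_topology)
  ultimately have "embedding_map X ?Y ?g" using X by (intro continuous_imp_embedding_map)
  then have "X homeomorphic_space subtopology ?Y (?g ` topspace X)"
    by (rule embedding_map_imp_homeomorphic_space)
  moreover have "metrizable_space ?Y"
  proof -
    have "countable {k\<in>B. \<not> (\<exists>a. topspace euclideanreal \<subseteq> {a})}"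
      by (rule countable_subset[OF _ B(1)]) auto
    then show ?thesis unfolding metrizable_space_product_topology by (simp add: metrizable_space_euclidean)
  qed
  ultimately show ?thesis using homeomorphic_metrizable_space metrizable_space_subtopology by blast
qed

text \<open>If only countably many coordinates are nontrivial, the space itself is metrizable.
  Otherwise the caliber property, applied to open sets on which such coordinates are large, gives a
  point of uncountable support.\<close>

lemma MA_omega1_imp_not_statement1:
  assumes MA: "MA_omega1 TYPE('a set)" shows "\<not> statement1 TYPE('a) TYPE('k)"
proof
  assume "statement1 TYPE('a) TYPE('k)"
  then obtain X :: "'a topology" where cor: "corson_compactum TYPE('k) X" and ccc: "ccc_space X"
    and nodense: "\<not> has_dense_metrizable_subspace X" unfolding statement1_def by blast
  then obtain f :: "'a \<Rightarrow> 'k \<Rightarrow> real" where X: "compact_space X" "Hausdorff_space X"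
    and f: "embedding_map X (subtopology (powertop_real UNIV) Sigma_product) f"
    unfolding corson_compactum_def by blast
  have cf: "continuous_map X (powertop_real UNIV) f" and fS: "f ` topspace X \<subseteq> Sigma_product"
    using f unfolding embedding_map_def homeomorphic_eq_everything_map
    by (auto simp: continuous_map_in_subtopology)
  have inj: "inj_on f (topspace X)"
    using f unfolding embedding_map_def by (simp add: homeomorphic_eq_everything_map)
  have ck: "continuous_map X euclideanreal (\<lambda>x. f x k)" for k
    using cf unfolding continuous_map_componentwise_UNIV by blast
  let ?B = "{k. \<exists>x\<in>topspace X. f x k \<noteq> 0}"
  show False
  proof (cases "countable ?B")
    case True
    have "metrizable_space X"
      by (rule metrizable_space_countably_many_coordinates[OF X(1) cf inj True]) auto
    then have "has_dense_metrizable_subspace X"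
      unfolding has_dense_metrizable_subspace_def by (intro exI[of _ "topspace X"]) simp
    then show False using nodense by blast
  next
    case False
    then obtain \<phi> where \<phi>: "inj_on \<phi> omega1" "\<phi> ` omega1 \<subseteq> ?B" by (rule omega1_inj_into_uncountable)
    have "\<exists>n. \<exists>x\<in>topspace X. 1 / Suc n < \<bar>f x (\<phi> \<alpha>)\<bar>" if \<alpha>: "\<alpha> \<in> omega1" for \<alpha>
    proof -
      obtain x where "x \<in> topspace X" "f x (\<phi> \<alpha>) \<noteq> 0" using \<phi>(2) \<alpha> by blast
      then show ?thesis using nat_approx_posE[of "\<bar>f x (\<phi> \<alpha>)\<bar>"] by (metis zero_less_abs_iff)
    qed
    then obtain n where n: "\<And>\<alpha>. \<alpha> \<in> omega1 \<Longrightarrow> \<exists>x\<in>topspace X. 1 / Suc (n \<alpha>) < \<bar>f x (\<phi> \<alpha>)\<bar>" by metis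
    \<comment> \<open>The bound \<open>1 / Suc (n \<alpha>)\<close> keeps the coordinate away from
      0, so that it is nonzero on the closure of \<open>V \<alpha>\<close> too.\<close>
    define V where "V \<alpha> = {x\<in>topspace X. f x (\<phi> \<alpha>) \<in> {y. 1 / Suc (n \<alpha>) < \<bar>y\<bar>}}" for \<alpha>
    have V_open: "openin X (V \<alpha>)" for \<alpha>
      unfolding V_def
      by (rule openin_continuous_map_preimage[OF ck]) (simp add: open_Collect_less continuous_intros)
    have V_ne: "V \<alpha> \<noteq> {}" if "\<alpha> \<in> omega1" for \<alpha>
      using n[OF that] unfolding V_def by blast
    obtain x where x: "x \<in> topspace X" "uncountable {\<alpha>\<in>omega1. x \<in> X closure_of V \<alpha>}"
      by (rule MA_omega1_imp_caliber[OF MA X(1) ccc, of V, OF V_open V_ne])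
    have "f x (\<phi> \<alpha>) \<noteq> 0" if "x \<in> X closure_of V \<alpha>" for \<alpha>
    proof -
      let ?C = "{x\<in>topspace X. f x (\<phi> \<alpha>) \<in> {y. 1 / Suc (n \<alpha>) \<le> \<bar>y\<bar>}}"
      have "closedin X ?C"
        by (rule closedin_continuous_map_preimage[OF ck]) (simp add: closed_Collect_le continuous_intros)
      then have "X closure_of V \<alpha> \<subseteq> ?C" by (intro closure_of_minimal) (auto simp: V_def)
      then have "1 / Suc (n \<alpha>) \<le> \<bar>f x (\<phi> \<alpha>)\<bar>" using that by blast
      moreover have "0 < 1 / real (Suc (n \<alpha>))" by simp
      ultimately show ?thesis by linarith
    qed
    then have "\<phi> ` {\<alpha>\<in>omega1. x \<in> X closure_of V \<alpha>} \<subseteq> {k. f x k \<noteq> 0}" by blast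
    moreover have "countable {k. f x k \<noteq> 0}" using fS x(1) unfolding Sigma_product_def by blast
    ultimately have "countable (\<phi> ` {\<alpha>\<in>omega1. x \<in> X closure_of V \<alpha>})" by (rule countable_subset)
    moreover have "inj_on \<phi> {\<alpha>\<in>omega1. x \<in> X closure_of V \<alpha>}" using \<phi>(1) by (rule inj_on_subset) blast
    ultimately show False using x(2) countable_image_inj_on by blast
  qed
qed

section \<open>From a failure of MA to the two spaces\<close>

context predense_family
begin

text \<open>\<open>good_family\<close> is instantiated by the finite sets of coordinates
  \<open>\<phi> \<alpha>\<close> whose conditions \<open>q \<alpha>\<close> have a common lower
  bound below \<open>q0\<close>. As no selection is centred, \<open>centered_imp_choice\<close>
  makes every set with only good finite subsets countable.\<close>

lemma statements_if_not_centered: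
  assumes none: "\<And>m. \<exists>Z. finite Z \<and> Z \<subseteq> omega1 \<and> \<not> (\<exists>p\<in>P. \<forall>\<xi>\<in>Z. le p (d \<xi> (m \<xi>)))"
  shows "statement1 TYPE(real \<Rightarrow> real) TYPE(real) \<and> statement2 TYPE(real \<Rightarrow> real)"
proof -
  obtain p t where pt: "\<And>\<alpha>. \<alpha> \<in> omega1 \<Longrightarrow> (p \<alpha>, t \<alpha>, {\<alpha>}) \<in> Q"
    using singleton_conditions by metis
  define q where "q \<alpha> = (p \<alpha>, t \<alpha>, {\<alpha>})" for \<alpha>
  have q: "q \<alpha> \<in> Q" if "\<alpha> \<in> omega1" for \<alpha> using pt[OF that] by (simp add: q_def)
  obtain q0 where q0: "q0 \<in> Q"
    "\<And>r. r \<in> Q \<Longrightarrow> leQ r q0 \<Longrightarrow> uncountable {\<alpha>\<in>omega1. compatible Q leQ r (q \<alpha>)}"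
    using ccc_poset_localize[where q = q, OF quasiorder_on_Q ccc_poset_Q q uncountable_omega1] by blast
  obtain \<phi> :: "nat set \<Rightarrow> real" where \<phi>: "inj_on \<phi> omega1"
    using at_most_aleph1_inj_real[OF at_most_aleph1_omega1] by blast
  \<comment> \<open>Lower bounds are taken below \<open>q0\<close>, where each condition is
    compatible with uncountably many \<open>q \<alpha>\<close>; this is the source of
    \<open>good_insert\<close>.\<close>
  define bd where "bd r F \<longleftrightarrow> r \<in> Q \<and> leQ r q0 \<and> (\<forall>\<alpha>\<in>omega1. \<phi> \<alpha> \<in> F \<longrightarrow> leQ r (q \<alpha>))" for r F
  define good where "good F \<longleftrightarrow> finite F \<and> F \<subseteq> \<phi> ` omega1 \<and> (\<exists>r. bd r F)" for F
  define \<C> where "\<C> = (\<lambda>\<alpha>. \<phi> ` preds \<alpha>) ` omega1"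
  have bd_le: "bd r F" if "bd s F" "leQ r s" "r \<in> Q" for r s F
  proof -
    have "leQ r x" if "leQ s x" "x \<in> Q" for x
      using quasiorder_on_trans[OF quasiorder_on_Q \<open>leQ r s\<close> that(1) \<open>r \<in> Q\<close> _ that(2)] \<open>bd s F\<close>
      unfolding bd_def by blast
    then show ?thesis using that q0(1) q unfolding bd_def by simp
  qed
  have goodI: "good F" if "finite F" "F \<subseteq> \<phi> ` omega1" "bd r F" for r F
    using that unfolding good_def by blast
  have bd_Un: "bd r (F \<union> G)" if "bd r F" "bd r G" for r F G
    using that unfolding bd_def by blast
  have in_range: "A \<subseteq> \<phi> ` omega1" if "\<And>\<beta>. \<beta> \<in> A \<Longrightarrow> good {\<beta>}" for A
    using that unfolding good_def by blast
  interpret good_family good \<C>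
  proof
    show "finite F" if "good F" for F using that by (simp add: good_def)
    have "leQ q0 q0" using quasiorder_on_refl[OF quasiorder_on_Q q0(1)] .
    then have "bd q0 {}" using q0(1) unfolding bd_def by simp
    then show "good {}" unfolding good_def by blast
    show "good G" if F: "good F" and sub: "G \<subseteq> F" for F G
    proof -
      obtain r where "bd r F" using F unfolding good_def by blast
      then have "bd r G" using sub unfolding bd_def by blast
      moreover have "finite G" "G \<subseteq> \<phi> ` omega1"
        using F sub finite_subset[OF sub] unfolding good_def by auto
      ultimately show ?thesis unfolding good_def by blast
    qed
    show "uncountable {\<beta>. good (insert \<beta> F)}" if F: "good F" for F
    proof -
      obtain r where r: "bd r F" using F unfolding good_def by blast
      let ?U = "{\<alpha>\<in>omega1. compatible Q leQ r (q \<alpha>)}"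
      have unc: "uncountable ?U" using q0(2) r unfolding bd_def by blast
      have "good (insert (\<phi> \<alpha>) F)" if \<alpha>: "\<alpha> \<in> ?U" for \<alpha>
      proof -
        obtain s where s: "s \<in> Q" "leQ s r" "leQ s (q \<alpha>)" using \<alpha> unfolding compatible_def by blast
        have sF: "bd s F" by (rule bd_le[OF r s(2,1)])
        then have "bd s {\<phi> \<alpha>}" using s(3) inj_onD[OF \<phi>] \<alpha> unfolding bd_def by blast
        then have "bd s ({\<phi> \<alpha>} \<union> F)" using sF by (rule bd_Un)
        then have "bd s (insert (\<phi> \<alpha>) F)" by simp
        moreover have "finite (insert (\<phi> \<alpha>) F)" "insert (\<phi> \<alpha>) F \<subseteq> \<phi> ` omega1"
          using F \<alpha> by (auto simp: good_def)
        ultimately show ?thesis by (intro goodI)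
      qed
      then have sub: "\<phi> ` ?U \<subseteq> {\<beta>. good (insert \<beta> F)}" by blast
      have "inj_on \<phi> ?U" by (rule inj_on_subset[OF \<phi>]) blast
      then have "uncountable (\<phi> ` ?U)" using unc countable_image_inj_on[of \<phi> ?U] by blast
      then show ?thesis using countable_subset[OF sub] by blast
    qed
    show "countable A" if A: "\<And>F. finite F \<Longrightarrow> F \<subseteq> A \<Longrightarrow> good F" for A
    proof (rule ccontr)
      assume unc: "uncountable A"
      let ?B = "{\<alpha>\<in>omega1. \<phi> \<alpha> \<in> A}"
      have "A \<subseteq> \<phi> ` omega1" by (rule in_range) (simp add: A)
      then have sub: "A \<subseteq> \<phi> ` ?B" by blast
      have uncB: "uncountable ?B" using unc countable_subset[OF sub countable_image] by blast
      have cent: "\<exists>p t F'. (p, t, F') \<in> Q \<and> F \<subseteq> F'" if F: "finite F" "F \<subseteq> ?B" for F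
      proof -
        have "good (\<phi> ` F)" using F by (intro A) auto
        then obtain r where r: "bd r (\<phi> ` F)" unfolding good_def by blast
        obtain p t F' where r_eq: "r = (p, t, F')" by (rule prod_cases3)
        \<comment> \<open>The last component of \<open>q \<alpha>\<close> is
          \<open>{\<alpha>}\<close>, so the common lower bound is a single condition containing all
          of \<open>F\<close>.\<close>
        have "\<alpha> \<in> F'" if "\<alpha> \<in> F" for \<alpha>
        proof -
          have "leQ r (q \<alpha>)" using r that F(2) unfolding bd_def by blast
          then show ?thesis by (simp add: r_eq q_def leQ_def)
        qed
        then show ?thesis using r unfolding bd_def r_eq by blast
      qed
      obtain m where "\<And>Z. finite Z \<Longrightarrow> Z \<subseteq> omega1 \<Longrightarrow> \<exists>p\<in>P. \<forall>\<xi>\<in>Z. le p (d \<xi> (m \<xi>))"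
        using centered_imp_choice[OF _ uncB cent] by blast
      then show False using none[of m] by blast
    qed
    show "\<exists>i\<in>S. \<exists>j\<in>S. i \<noteq> j \<and> good (f i \<union> f j)"
      if S: "uncountable S" and f: "\<And>i. i \<in> S \<Longrightarrow> good (f i)" for S :: "(real \<Rightarrow> real) set set" and f
    proof -
      have "\<forall>i\<in>S. \<exists>r. bd r (f i)" using f unfolding good_def by blast
      then obtain r where r: "\<And>i. i \<in> S \<Longrightarrow> bd (r i) (f i)" by metis
      have "r i \<in> Q" if "i \<in> S" for i using r[OF that] unfolding bd_def by blast
      then obtain i j where ij: "i \<in> S" "j \<in> S" "i \<noteq> j" "compatible Q leQ (r i) (r j)"
        by (rule ccc_poset_family[OF quasiorder_on_Q ccc_poset_Q S])
      obtain s where s: "s \<in> Q" "leQ s (r i)" "leQ s (r j)" using ij(4) unfolding compatible_def by blast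
      have "bd s (f i \<union> f j)"
        using bd_Un[OF bd_le[OF r[OF ij(1)] s(2,1)] bd_le[OF r[OF ij(2)] s(3,1)]] .
      moreover have "finite (f i \<union> f j)" "f i \<union> f j \<subseteq> \<phi> ` omega1"
        using f[OF ij(1)] f[OF ij(2)] by (simp_all add: good_def)
      ultimately have "good (f i \<union> f j)" by (intro goodI)
      then show ?thesis using ij(1-3) by blast
    qed
    show "at_most_aleph1 \<C>"
      unfolding \<C>_def by (rule at_most_aleph1_image[OF at_most_aleph1_omega1])
    show "countable C" if "C \<in> \<C>" for C
      using that countable_preds unfolding \<C>_def by auto
    show "\<exists>C\<in>\<C>. A \<subseteq> C" if A: "countable A" "\<And>\<beta>. \<beta> \<in> A \<Longrightarrow> good {\<beta>}" for A
    proof -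
      let ?B = "{\<alpha>\<in>omega1. \<phi> \<alpha> \<in> A}"
      have "countable (\<phi> ` ?B)" using A(1) by (rule countable_subset[rotated]) blast
      moreover have "inj_on \<phi> ?B" by (rule inj_on_subset[OF \<phi>]) blast
      ultimately have "countable ?B" by (rule countable_image_inj_on)
      then obtain \<alpha> where \<alpha>: "\<alpha> \<in> omega1" "?B \<subseteq> preds \<alpha>" by (rule omega1_bounds_countable) blast
      have "A \<subseteq> \<phi> ` omega1" by (rule in_range) (rule A(2))
      then have "A \<subseteq> \<phi> ` preds \<alpha>" using \<alpha>(2) by blast
      then show ?thesis using \<alpha>(1) unfolding \<C>_def by blast
    qed
  qed
  show ?thesis by (rule statements)
qed

end

text \<open>These sets turn a centred set into a directed one: a member compatible with both
  \<open>p\<close> and \<open>q\<close> is already below both. For density, go below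
  \<open>p\<close> and then below \<open>q\<close> as far as compatibility allows.\<close>

lemma dense_deciding_set:
  assumes pre: "quasiorder_on P le" and p: "p \<in> P" and q: "q \<in> P"
  shows "dense_in_poset P le
    {r\<in>P. (le r p \<and> le r q) \<or> \<not> compatible P le r p \<or> \<not> compatible P le r q}"
    (is "dense_in_poset P le ?D")
  unfolding dense_in_poset_def
proof (intro conjI ballI)
  fix s assume s: "s \<in> P"
  show "\<exists>r\<in>?D. le r s"
  proof (cases "compatible P le s p")
    case False
    then show ?thesis using s quasiorder_on_refl[OF pre s] by blast
  next
    case True
    then obtain r where r: "r \<in> P" "le r s" "le r p" unfolding compatible_def by blast
    show ?thesis
    proof (cases "compatible P le r q")
      case False
      then show ?thesis using r by blast
    next
      case True
      then obtain r' where r': "r' \<in> P" "le r' r" "le r' q" unfolding compatible_def by blast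
      have "le r' p" "le r' s"
        using quasiorder_on_trans[OF pre r'(2) r(3) r'(1) r(1) p]
          quasiorder_on_trans[OF pre r'(2) r(2) r'(1) r(1) s] .
      then show ?thesis using r' by blast
    qed
  qed
qed blast

text \<open>A maximal antichain inside \<open>D\<close> is countable and, by the density of
  \<open>D\<close>, predense in all of \<open>P\<close>. Its enumeration may repeat values.\<close>

lemma dense_predense_enumeration:
  assumes pre: "quasiorder_on P le" and ccc: "ccc_poset P le" and ne: "P \<noteq> {}"
    and D: "dense_in_poset P le D"
  obtains d :: "nat \<Rightarrow> 'p" where "\<And>n. d n \<in> D" "\<And>p. p \<in> P \<Longrightarrow> \<exists>n. compatible P le p (d n)"
proof -
  have DP: "D \<subseteq> P" using D unfolding dense_in_poset_def by blast
  obtain A where A: "countable A" "A \<subseteq> D" "\<And>s. s \<in> D \<Longrightarrow> \<exists>a\<in>A. compatible P le s a"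
    by (rule ccc_poset_maximal_antichain[OF pre ccc DP]) blast
  have predense: "\<exists>a\<in>A. compatible P le p a" if p: "p \<in> P" for p
  proof -
    obtain s where s: "s \<in> D" "le s p" using D p unfolding dense_in_poset_def by blast
    obtain a r where a: "a \<in> A" "r \<in> P" "le r s" "le r a" using A(3)[OF s(1)] unfolding compatible_def by blast
    have "le r p" using quasiorder_on_trans[OF pre a(3) s(2) a(2) _ p] s(1) DP by blast
    then show ?thesis using a unfolding compatible_def by blast
  qed
  then have "A \<noteq> {}" using ne by blast
  show ?thesis
  proof (rule that[of "from_nat_into A"])
    show "from_nat_into A n \<in> D" for n using from_nat_into[OF \<open>A \<noteq> {}\<close>] A(2) by blast
    show "\<exists>n. compatible P le p (from_nat_into A n)" if "p \<in> P" for p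
      using predense[OF that] from_nat_into_surj[OF A(1)] by metis
  qed
qed

text \<open>A counterexample is cut down to size aleph_1, so that the deciding sets of all pairs can
  join its dense sets. A centred selection from all of these would generate a filter excluded by the
  choice of \<open>P\<close>.\<close>

lemma not_MA_omega1_imp_statements:
  assumes "\<not> MA_omega1 TYPE('p)"
  shows "statement1 TYPE(real \<Rightarrow> real) TYPE(real) \<and> statement2 TYPE(real \<Rightarrow> real)"
proof -
  obtain P :: "'p set" and le \<D> where P: "poset_on P le" "P \<noteq> {}" "ccc_poset P le"
    and \<D>: "at_most_aleph1 \<D>" "\<forall>D\<in>\<D>. dense_in_poset P le D"
    and no_filter: "\<not> (\<exists>G. filter_on P le G \<and> (\<forall>D\<in>\<D>. G \<inter> D \<noteq> {}))"
    using assms unfolding MA_omega1_def not_all not_imp by (elim exE conjE)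
  note preP = poset_on_imp_quasiorder_on[OF P(1)]
  obtain P' where P': "P' \<subseteq> P" "P' \<noteq> {}" "at_most_aleph1 P'"
    and compat: "\<And>p q. p \<in> P' \<Longrightarrow> q \<in> P' \<Longrightarrow> compatible P le p q \<Longrightarrow> compatible P' le p q"
    and dense: "\<And>D. D \<in> \<D> \<Longrightarrow> dense_in_poset P' le (D \<inter> P')"
    using subposet_aleph1[OF preP P(2) \<D>(1)] \<D>(2) by blast
  have ccc': "ccc_poset P' le" by (rule ccc_subposet[OF P(3) P'(1) compat])
  have pre': "quasiorder_on P' le" using preP P'(1) unfolding quasiorder_on_def by blast
  define Dec where "Dec = (\<lambda>(p, q).
    {r\<in>P'. (le r p \<and> le r q) \<or> \<not> compatible P' le r p \<or> \<not> compatible P' le r q})"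
  let ?E = "(\<lambda>D. D \<inter> P') ` \<D> \<union> Dec ` (P' \<times> P')"
  have "at_most_aleph1 ?E"
    by (intro at_most_aleph1_Un at_most_aleph1_image at_most_aleph1_Times \<D>(1) P'(3))
  then obtain g where g: "?E \<subseteq> g ` omega1" unfolding at_most_aleph1_iff by blast
  have E_dense: "dense_in_poset P' le D" if "D \<in> ?E" for D
    using that dense dense_deciding_set[OF pre'] by (auto simp: Dec_def)
  have P'_dense: "dense_in_poset P' le P'"
    using quasiorder_on_refl[OF pre'] unfolding dense_in_poset_def by blast
  \<comment> \<open>\<open>g\<close> may take values outside the family \<open>?E\<close>; there the
    whole of \<open>P'\<close> serves as the dense set.\<close>
  define E where "E \<xi> = (if g \<xi> \<in> ?E then g \<xi> else P')" for \<xi>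
  have E: "dense_in_poset P' le (E \<xi>)" for \<xi>
    unfolding E_def using E_dense P'_dense by simp
  have "\<exists>d :: nat \<Rightarrow> 'p. (\<forall>n. d n \<in> E \<xi>) \<and> (\<forall>p\<in>P'. \<exists>n. compatible P' le p (d n))" for \<xi>
    using dense_predense_enumeration[OF pre' ccc' P'(2) E[of \<xi>]] by metis
  then obtain d :: "nat set \<Rightarrow> nat \<Rightarrow> 'p" where dE: "\<And>\<xi> n. d \<xi> n \<in> E \<xi>"
    "\<And>\<xi> p. p \<in> P' \<Longrightarrow> \<exists>n. compatible P' le p (d \<xi> n)" by metis
  have dP': "d \<xi> n \<in> P'" for \<xi> n using dE(1) E unfolding dense_in_poset_def by blast
  interpret predense_family P' le d
    by unfold_locales (use pre' ccc' P'(2) dP' dE(2) in auto)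
  show ?thesis
  proof (rule statements_if_not_centered, rule ccontr)
    fix m assume "\<nexists>Z. finite Z \<and> Z \<subseteq> omega1 \<and> \<not> (\<exists>p\<in>P'. \<forall>\<xi>\<in>Z. le p (d \<xi> (m \<xi>)))"
    then have cent: "\<exists>p\<in>P'. \<forall>\<xi>\<in>Z. le p (d \<xi> (m \<xi>))" if "finite Z" "Z \<subseteq> omega1" for Z
      using that by blast
    define H where "H = (\<lambda>\<xi>. d \<xi> (m \<xi>)) ` omega1"
    have HP: "H \<subseteq> P'" using dP' unfolding H_def by blast
    have H_compat: "compatible P' le p q" if pq: "p \<in> H" "q \<in> H" for p q
    proof -
      obtain \<xi> \<eta> where "\<xi> \<in> omega1" "\<eta> \<in> omega1" "p = d \<xi> (m \<xi>)" "q = d \<eta> (m \<eta>)"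
        using pq unfolding H_def by blast
      then show ?thesis using cent[of "{\<xi>, \<eta>}"] unfolding compatible_def by auto
    qed
    have H_meets: "\<exists>r\<in>H. r \<in> D" if D: "D \<in> ?E" for D
    proof -
      obtain \<xi> where "\<xi> \<in> omega1" "g \<xi> = D"
        using subsetD[OF g D] by (elim imageE) simp
      have "E \<xi> = D" unfolding E_def \<open>g \<xi> = D\<close> using D by (rule if_P)
      then have "d \<xi> (m \<xi>) \<in> D" "d \<xi> (m \<xi>) \<in> H"
        using dE(1)[of \<xi> "m \<xi>"] \<open>\<xi> \<in> omega1\<close> unfolding H_def by simp_all
      then show ?thesis by blast
    qed
    have "H \<noteq> {}" unfolding H_def using uncountable_omega1 by auto
    \<comment> \<open>\<open>H\<close> meets \<open>Dec (p, q)\<close> in an element compatible with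
      both \<open>p\<close> and \<open>q\<close>, hence below both.\<close>
    have directed: "\<exists>r\<in>H. le r p \<and> le r q" if pq: "p \<in> H" "q \<in> H" for p q
    proof -
      have "(p, q) \<in> P' \<times> P'" using pq HP by blast
      then have "Dec (p, q) \<in> ?E" by (intro UnI2 imageI)
      then obtain r where "r \<in> H" "r \<in> Dec (p, q)" using H_meets by blast
      then show ?thesis using H_compat pq unfolding Dec_def by blast
    qed
    have "filter_on P le {p\<in>P. \<exists>g\<in>H. le g p}"
      by (rule filter_on_upward_closure[OF preP P'(1) HP \<open>H \<noteq> {}\<close> directed])
    then obtain D where D: "D \<in> \<D>" "{p\<in>P. \<exists>g\<in>H. le g p} \<inter> D = {}" using no_filter by meson
    obtain r where r: "r \<in> H" "r \<in> D \<inter> P'"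
      using H_meets[OF UnI1[OF imageI[OF D(1)]]] by blast
    then have "r \<in> P" "le r r" using P'(1) quasiorder_on_refl[OF preP] by blast+
    then show False using D(2) r by blast
  qed
qed

text \<open>Types cannot be quantified inside a formula, so the equivalence is spread over free type
  variables: a space on any type refutes the axiom for \<open>real\<close>, and a failure on any
  type gives both spaces on fixed types. The axiom for \<open>real\<close> implies it for every
  type, in particular for posets of open sets.\<close>

theorem mainTheorem4:
  shows "(statement1 TYPE('a) TYPE('k) \<longrightarrow> \<not> MA_omega1 TYPE(real)) \<and>
         (statement2 TYPE('b) \<longrightarrow> \<not> MA_omega1 TYPE(real)) \<and>
         (\<not> MA_omega1 TYPE('p) \<longrightarrow>
            statement1 TYPE(real \<Rightarrow> real) TYPE(real) \<and> statement2 TYPE(real \<Rightarrow> real))"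
  using MA_omega1_imp_not_statement1[OF MA_omega1_real_imp_MA_omega1, where 'a = 'a and 'k = 'k]
    MA_omega1_imp_not_statement2[OF MA_omega1_real_imp_MA_omega1, where 'b = 'b]
    not_MA_omega1_imp_statements[where 'p = 'p]
  by blast

end
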